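(* Let $z,w\in S_{\ell_\infty}$ be such that $\mathcal{GP}_{\mathcal A_u}(\delta_z)=\mathcal{GP}_{\mathcal A_u}(\delta_w)$. Then there exist $\varphi\in\mathcal M_z(\mathcal H^\infty(B_{c_0}))$ and $\psi\in\mathcal M_w(\mathcal H^\infty(B_{c_0}))$ satisfying $\mathcal{GP}_{\mathcal H^\infty}(\varphi)=\mathcal{GP}_{\mathcal H^\infty}(\psi)$.
   Context: $c_0$ is the complex Banach space of null sequences, with dual $\ell_1$ and bidual $\ell_\infty$; $B_{c_0}$ is its open unit ball; $\overline B_{\ell_\infty}$ and $S_{\ell_\infty}$ are the closed unit ball and unit sphere of $\ell_\infty$. $\mathcal H^\infty(B_{c_0})$ is the Banach algebra (sup norm) of bounded holomorphic functions $f\colon B_{c_0}\to\mathbb C$, and $\mathcal A_u(B_{c_0})$ its subalgebra of uniformly continuous functions. Each $f\in\mathcal A_u(B_{c_0})$ has a unique weak-star ($w(\ell_\infty,\ell_1)$) continuous extension $\tilde f$ to $\overline B_{\ell_\infty}$ (the canonical extension), and for $z\in\overline B_{\ell_\infty}$, $\delta_z\in\mathcal M(\mathcal A_u(B_{c_0}))$ is $\delta_z(f)=\tilde f(z)$. For $\mathcal A$ either of these algebras, $\mathcal M(\mathcal A)$ is the set of nonzero $\mathbb C$-valued algebra homomorphisms on $\mathcal A$. The map $\pi\colon\mathcal M(\mathcal A)\to\overline B_{\ell_\infty}$ is $\pi(\varphi)=\varphi|_{\ell_1}$ (with $\ell_1=c_0^*\subset\mathcal A$), and the fiber over $z\in\overline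 B_{\ell_\infty}$ is $\mathcal M_z(\mathcal A)=\{\varphi\in\mathcal M(\mathcal A) \mid \pi(\varphi)=z\}$. The pseudo-hyperbolic distance is $\rho(\varphi,\psi)=\sup\{|\varphi(f)| \mid f\in\mathcal A,\ \|f\|\le1,\ \psi(f)=0\}$, and the Gleason part of $\varphi$ is $\{\psi\in\mathcal M(\mathcal A) \mid \rho(\varphi,\psi)<1\}$ (equivalently $\|\varphi-\psi\|<2$ in $\mathcal A^*$); it is denoted $\mathcal{GP}_{\mathcal A_u}(\varphi)$ when $\mathcal A=\mathcal A_u(B_{c_0})$ and $\mathcal{GP}_{\mathcal H^\infty}(\varphi)$ when $\mathcal A=\mathcal H^\infty(B_{c_0})$. *)

theory Defs
  imports "HOL-Analysis.Analysis"
begin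

section \<open>The spaces $c_0$, $\ell_1$ and $\ell_\infty$\<close>

text \<open>Since \<^typ>\<open>nat\<close> is discrete, its bounded continuous functions are exactly the bounded
  sequences; the library norm is the supremum norm.\<close>

type_synonym linf = "nat \<Rightarrow>\<^sub>C complex"

typedef c0 = "{x :: linf. apply_bcontfun x \<longlonglongrightarrow> 0}"
  morphisms c0_linf Abs_c0
  by (rule exI[of _ 0]) simp

setup_lifting type_definition_c0

instantiation c0 :: real_vector
begin

lift_definition zero_c0 :: c0 is 0 by simp
lift_definition uminus_c0 :: "c0 \<Rightarrow> c0" is uminus
  by (auto simp: uminus_bcontfun.rep_eq intro: tendsto_eq_intros)
lift_definition plus_c0 :: "c0 \<Rightarrow> c0 \<Rightarrow> c0" is "(+)"
  by (auto simp: plus_bcontfun.rep_eq intro: tendsto_eq_intros)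
lift_definition minus_c0 :: "c0 \<Rightarrow> c0 \<Rightarrow> c0" is "(-)"
  by (auto simp: minus_bcontfun.rep_eq intro: tendsto_eq_intros)
lift_definition scaleR_c0 :: "real \<Rightarrow> c0 \<Rightarrow> c0" is "(*\<^sub>R)"
  by (simp only: mem_Collect_eq scaleR_bcontfun.rep_eq) (rule tendsto_eq_intros refl | simp)+

instance
  by standard (transfer; simp add: algebra_simps)+

end

instantiation c0 :: real_normed_vector
begin

lift_definition norm_c0 :: "c0 \<Rightarrow> real" is norm .
lift_definition dist_c0 :: "c0 \<Rightarrow> c0 \<Rightarrow> real" is dist .
lift_definition sgn_c0 :: "c0 \<Rightarrow> c0" is sgn
  by (simp only: mem_Collect_eq sgn_bcontfun_def scaleR_bcontfun.rep_eq)
    (rule tendsto_eq_intros refl | simp)+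

definition uniformity_c0 :: "(c0 \<times> c0) filter"
  where "uniformity_c0 = (INF e\<in>{0<..}. principal {(x, y). dist x y < e})"

definition open_c0 :: "c0 set \<Rightarrow> bool"
  where "open_c0 S = (\<forall>x\<in>S. \<forall>\<^sub>F (x', y) in uniformity. x' = x \<longrightarrow> y \<in> S)"

instance
proof
  fix x y :: c0 and a :: real
  show "dist x y = norm (x - y)" by transfer (rule dist_norm)
  show "sgn x = x /\<^sub>R norm x" by transfer (rule sgn_div_norm)
  show "norm x = 0 \<longleftrightarrow> x = 0" by transfer (rule norm_eq_zero)
  show "norm (x + y) \<le> norm x + norm y" by transfer (rule norm_triangle_ineq)
  show "norm (a *\<^sub>R x) = \<bar>a\<bar> * norm x" by transfer (rule norm_scaleR)
qed (rule uniformity_c0_def open_c0_def)+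

end

instance c0 :: banach
proof
  fix X :: "nat \<Rightarrow> c0"
  assume "Cauchy X"
  then have "Cauchy (\<lambda>n. c0_linf (X n))"
    unfolding Cauchy_def dist_c0.rep_eq .
  then have "\<forall>e>0. \<exists>N. \<forall>m n k. N \<le> m \<and> N \<le> n \<and> True \<longrightarrow>
      dist (apply_bcontfun (c0_linf (X m)) k) (apply_bcontfun (c0_linf (X n)) k) < e"
    unfolding Cauchy_def by (meson dist_fun_lt_imp_dist_val_lt)
  then obtain g where "\<forall>e>0. \<exists>N. \<forall>n k. N \<le> n \<and> True \<longrightarrow>
      dist (apply_bcontfun (c0_linf (X n)) k) (g k) < e"
    using uniformly_convergent_eq_cauchy[of "\<lambda>_. True" "\<lambda>n. apply_bcontfun (c0_linf (X n))"]
    by metis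
  then have "uniform_limit UNIV (\<lambda>n. apply_bcontfun (c0_linf (X n))) g sequentially"
    unfolding uniform_limit_sequentially_iff by simp
  then obtain L where L: "(\<lambda>n. c0_linf (X n)) \<longlonglongrightarrow> L"
    by (rule uniform_limit_bcontfunE[OF _ sequentially_bot])
  have "apply_bcontfun L \<longlonglongrightarrow> 0"
  proof (rule swap_uniform_limit')
    show "uniform_limit UNIV (\<lambda>n. apply_bcontfun (c0_linf (X n))) L sequentially"
      by (rule tendsto_bcontfun_uniform_limit[OF L])
    show "\<forall>\<^sub>F n in sequentially. apply_bcontfun (c0_linf (X n)) \<longlonglongrightarrow> 0"
      using c0_linf by (intro always_eventually) blast
    show "(\<lambda>_::nat. 0::complex) \<longlonglongrightarrow> 0"
      by (rule tendsto_const)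
  qed simp_all
  then have "c0_linf (Abs_c0 L) = L"
    by (intro Abs_c0_inverse) simp
  then have "X \<longlonglongrightarrow> Abs_c0 L"
    using L unfolding tendsto_iff dist_c0.rep_eq by simp
  then show "convergent X" by (rule convergentI)
qed

context
  includes bcontfun.lifting
begin

lift_definition linf_scaleC :: "complex \<Rightarrow> linf \<Rightarrow> linf" is "\<lambda>c x n. c * x n"
proof -
  fix c :: complex and f :: "nat \<Rightarrow> complex"
  assume "f \<in> bcontfun"
  then show "(\<lambda>n. c * f n) \<in> bcontfun"
    using bounded_linear_image[OF _ bounded_linear_mult_right[of c], of "range f"]
    by (simp add: bcontfun_def image_image)
qed

end

lift_definition c0_scaleC :: "complex \<Rightarrow> c0 \<Rightarrow> c0" is linf_scaleC
  by (simp add: linf_scaleC.rep_eq tendsto_mult_right_zero)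

definition ell1 :: "(nat \<Rightarrow> complex) set"
  where "ell1 = {a. summable (\<lambda>n. norm (a n))}"

definition pairing :: "(nat \<Rightarrow> complex) \<Rightarrow> linf \<Rightarrow> complex"
  where "pairing a x = (\<Sum>n. a n * apply_bcontfun x n)"

definition weak_star :: "linf topology"
  where "weak_star = topology_generated_by {{x. pairing a x \<in> U} | a U. a \<in> ell1 \<and> open U}"

section \<open>The algebras and their spectra\<close>

text \<open>Functions on the open ball (and functionals on an algebra) are represented by
  \<^const>\<open>extensional\<close> functions, so that equality of representatives is equality on the
  intended domain. Holomorphy is complex Frechet differentiability.\<close>

definition Hinf :: "(c0 \<Rightarrow> complex) set"
  where "Hinf = {f \<in> extensional (ball 0 1).
    (\<forall>x\<in>ball 0 1. \<exists>D. (f has_derivative D) (at x) \<and> (\<forall>c h. D (c0_scaleC c h) = c * D h)) \<and>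
    bounded (f ` ball 0 1)}"

definition Au :: "(c0 \<Rightarrow> complex) set"
  where "Au = {f \<in> Hinf. uniformly_continuous_on (ball 0 1) f}"

definition supnorm :: "(c0 \<Rightarrow> complex) \<Rightarrow> real"
  where "supnorm f = (SUP x\<in>ball 0 1. norm (f x))"

text \<open>The parameter \<open>A\<close> below is intended to be \<open>Hinf\<close> or \<open>Au\<close>.\<close>

definition char_space :: "(c0 \<Rightarrow> complex) set \<Rightarrow> ((c0 \<Rightarrow> complex) \<Rightarrow> complex) set"
  where "char_space A = {\<phi> \<in> extensional A.
    (\<forall>f\<in>A. \<forall>g\<in>A. \<phi> (\<lambda>x\<in>ball 0 1. f x + g x) = \<phi> f + \<phi> g) \<and>
    (\<forall>c. \<forall>f\<in>A. \<phi> (\<lambda>x\<in>ball 0 1. c * f x) = c * \<phi> f) \<and>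
    (\<forall>f\<in>A. \<forall>g\<in>A. \<phi> (\<lambda>x\<in>ball 0 1. f x * g x) = \<phi> f * \<phi> g) \<and>
    (\<exists>f\<in>A. \<phi> f \<noteq> 0)}"

definition ell1_fun :: "(nat \<Rightarrow> complex) \<Rightarrow> c0 \<Rightarrow> complex"
  where "ell1_fun a = (\<lambda>x\<in>ball 0 1. pairing a (c0_linf x))"

text \<open>The restriction of a homomorphism to $\ell_1 = c_0^*$, regarded as an element of
  $\ell_\infty = \ell_1^*$.\<close>

definition char_proj :: "((c0 \<Rightarrow> complex) \<Rightarrow> complex) \<Rightarrow> linf"
  where "char_proj \<phi> = (THE z. \<forall>a\<in>ell1. \<phi> (ell1_fun a) = pairing a z)"

definition fiber :: "(c0 \<Rightarrow> complex) set \<Rightarrow> linf \<Rightarrow> ((c0 \<Rightarrow> complex) \<Rightarrow> complex) set"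
  where "fiber A z = {\<phi> \<in> char_space A. char_proj \<phi> = z}"

definition pseudo_hyp ::
  "(c0 \<Rightarrow> complex) set \<Rightarrow> ((c0 \<Rightarrow> complex) \<Rightarrow> complex) \<Rightarrow> ((c0 \<Rightarrow> complex) \<Rightarrow> complex) \<Rightarrow> real"
  where "pseudo_hyp A \<phi> \<psi> = Sup {norm (\<phi> f) | f. f \<in> A \<and> supnorm f \<le> 1 \<and> \<psi> f = 0}"

definition gleason_part ::
  "(c0 \<Rightarrow> complex) set \<Rightarrow> ((c0 \<Rightarrow> complex) \<Rightarrow> complex) \<Rightarrow> ((c0 \<Rightarrow> complex) \<Rightarrow> complex) set"
  where "gleason_part A \<phi> = {\<psi> \<in> char_space A. pseudo_hyp A \<phi> \<psi> < 1}"

text \<open>For \<open>f \<in> Au\<close> the weak-star continuous extension exists (such \<open>f\<close> are uniform limits of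
  polynomials, which on $c_0$ are weakly continuous on bounded sets) and is unique by weak-star
  density of $B_{c_0}$ in the closed ball.\<close>

definition canonical_ext :: "(c0 \<Rightarrow> complex) \<Rightarrow> linf \<Rightarrow> complex"
  where "canonical_ext f = (THE g. g \<in> extensional (cball 0 1) \<and>
    continuous_map (subtopology weak_star (cball 0 1)) euclidean g \<and>
    (\<forall>x\<in>ball 0 1. g (c0_linf x) = f x))"

definition delta :: "linf \<Rightarrow> (c0 \<Rightarrow> complex) \<Rightarrow> complex"
  where "delta z = (\<lambda>f\<in>Au. canonical_ext f z)"

end

theory Submission
  imports "HOL-Complex_Analysis.Complex_Analysis" Defs
begin

text \<open>
  For \<open>f\<close> in \<^const>\<open>Au\<close> the values \<open>f (P x)\<close> at the truncations of \<open>x\<close> converge to \<open>f x\<close> uniformly on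
  the ball. Otherwise \<open>f\<close> has a large difference \<open>f (p + b) - f p\<close> with \<open>b\<close> supported far out. By a
  Bessel inequality such differences are small at a fixed \<open>p\<close>, so the difference must be due to
  the part of \<open>p\<close> that is also supported far out, and \<open>f\<close> has a large second mixed difference with
  respect to two disjoint blocks supported far out. Iterating gives large mixed differences of every order,
  but on the ball of radius 1/8 the Schwarz lemma bounds those of order \<open>m\<close> by \<open>4\<close> to the power \<open>- m\<close>.
  A one-variable argument along \<open>\<lambda> \<mapsto> \<lambda> x\<close> passes from this ball to the unit ball. Hence the canonical
  extension at \<open>z\<close> is the limit of the values at the points \<open>z\<^sub>k\<close>, the scaled truncations of \<open>z\<close>,
  and \<open>\<delta>\<^sub>z\<close> is a character.

  If \<open>\<delta>\<^sub>z\<close> and \<open>\<delta>\<^sub>w\<close> lie in the same part, Moebius transforms of the coordinates show that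
  the coordinates of \<open>z\<^sub>k\<close> and \<open>w\<^sub>k\<close> have pseudo-hyperbolic distance at most some \<open>c < 1\<close>. An analytic
  disc through \<open>z\<^sub>k\<close> and \<open>w\<^sub>k\<close> transfers this bound to all of \<^const>\<open>Hinf\<close>. By compactness the
  evaluations at \<open>z\<^sub>k\<close> and at \<open>w\<^sub>k\<close> converge along a common filter, and the limit characters lie in the
  required fibers at pseudo-hyperbolic distance at most \<open>c\<close>.
\<close>

section \<open>Coordinates and truncations\<close>


abbreviation cc :: "c0 \<Rightarrow> nat \<Rightarrow> complex"
  where "cc x \<equiv> apply_bcontfun (c0_linf x)"

lemma cc_simps [simp]:
  "cc 0 n = 0" "cc (x + y) n = cc x n + cc y n" "cc (x - y) n = cc x n - cc y n"
  "cc (c0_scaleC a x) n = a * cc x n" "cc (r *\<^sub>R x) n = r *\<^sub>R cc x n"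
  by (simp_all add: zero_c0.rep_eq plus_c0.rep_eq minus_c0.rep_eq c0_scaleC.rep_eq
      scaleR_c0.rep_eq linf_scaleC.rep_eq zero_bcontfun.rep_eq plus_bcontfun.rep_eq minus_bcontfun.rep_eq)

lemma cc_sum [simp]: "cc (\<Sum>k\<in>K. g k) n = (\<Sum>k\<in>K. cc (g k) n)"
  by (induction K rule: infinite_finite_induct) auto

lemma c0_eqI: "x = y" if "\<And>n. cc x n = cc y n"
  using that by (metis apply_bcontfun_inject c0_linf_inject ext)

lemma norm_cc_le: "norm (cc x n) \<le> norm x"
  by (simp add: norm_c0.rep_eq norm_bounded)

lemma norm_c0_le: "norm x \<le> B" if "\<And>n. norm (cc x n) \<le> B"
  unfolding norm_c0.rep_eq using that by (rule norm_bound)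

lemma cc_tendsto_0: "cc x \<longlonglongrightarrow> 0"
  using c0_linf[of x] by simp

lemma c0_scaleC_add_left: "c0_scaleC (a + b) x = c0_scaleC a x + c0_scaleC b x"
  by (rule c0_eqI) (simp add: algebra_simps)

lemma c0_scaleC_one [simp]: "c0_scaleC 1 x = x"
  and c0_scaleC_zero [simp]: "c0_scaleC 0 x = 0"
  and c0_scaleC_zero_right [simp]: "c0_scaleC a 0 = 0"
  by (auto intro!: c0_eqI)

lemma norm_c0_scaleC_le: "norm (c0_scaleC a x) \<le> norm a * norm x"
  by (rule norm_c0_le) (simp add: norm_mult mult_left_mono norm_cc_le)

lemma bounded_linear_c0_scaleC: "bounded_linear (\<lambda>a. c0_scaleC a x)"
  by (rule bounded_linear_intro[where K = "norm x"])
     (auto simp: c0_scaleC_add_left norm_c0_scaleC_le intro!: c0_eqI)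

lemma initial_segment_fun_bcontfun: "(\<lambda>n::nat. if n < N then z n else 0) \<in> bcontfun" (is "?g \<in> _")
  for z :: "nat \<Rightarrow> complex"
proof -
  have "finite (?g ` {n. n < N} \<union> {0})" by simp
  moreover have "range ?g \<subseteq> ?g ` {n. n < N} \<union> {0}" by auto
  ultimately have "bounded (range ?g)" using finite_imp_bounded finite_subset by blast
  then show ?thesis by (simp add: bcontfun_def)
qed

text \<open>The sequence is arbitrary and need not be bounded, so the same constructor serves for
  truncations of points of \<open>c0\<close> and \<open>linf\<close>, for unit vectors and for
  points whose coordinates are functions of a complex parameter.\<close>

lift_definition initial_segment :: "nat \<Rightarrow> (nat \<Rightarrow> complex) \<Rightarrow> c0"
  is "\<lambda>N z. Bcontfun (\<lambda>n. if n < N then z n else 0)"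
proof -
  fix N and z :: "nat \<Rightarrow> complex"
  show "apply_bcontfun (Bcontfun (\<lambda>n. if n < N then z n else 0)) \<longlonglongrightarrow> 0"
    unfolding Bcontfun_inverse[OF initial_segment_fun_bcontfun]
    by (rule tendsto_eventually) (auto intro: eventually_sequentiallyI[of N])
qed

lemma cc_initial_segment [simp]: "cc (initial_segment N z) n = (if n < N then z n else 0)"
  by (simp add: initial_segment.rep_eq Bcontfun_inverse[OF initial_segment_fun_bcontfun])

abbreviation trunc :: "nat \<Rightarrow> c0 \<Rightarrow> c0"
  where "trunc N x \<equiv> initial_segment N (cc x)"

lemma norm_initial_segment_le: "norm (initial_segment N z) \<le> B" if "0 \<le> B" "\<And>n. n < N \<Longrightarrow> norm (z n) \<le> B"
  by (rule norm_c0_le) (simp add: that)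

lemma norm_trunc_le: "norm (trunc N x) \<le> norm x"
  by (rule norm_initial_segment_le) (simp_all add: norm_cc_le)

text \<open>Strictness survives because only finitely many coordinates matter and their maximum is
  attained; inserting 0 covers \<open>N = 0\<close>.\<close>

lemma norm_initial_segment_less_1: "norm (initial_segment N z) < 1" if "\<And>n. n < N \<Longrightarrow> norm (z n) < 1"
proof -
  define B where "B = Max (insert 0 ((\<lambda>n. norm (z n)) ` {..<N}))"
  have "norm (initial_segment N z) \<le> B" unfolding B_def by (rule norm_initial_segment_le) auto
  also have "B < 1" unfolding B_def using that by (subst Max_less_iff) auto
  finally show ?thesis .
qed

lemma trunc_tendsto: "(\<lambda>N. trunc N x) \<longlonglongrightarrow> x"
proof (rule LIMSEQ_I)
  fix r :: real assume "0 < r"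
  then obtain N where N: "\<And>n. n \<ge> N \<Longrightarrow> norm (cc x n) < r / 2"
    using LIMSEQ_D[OF cc_tendsto_0[of x], of "r / 2"] by auto
  have "norm (trunc M x - x) < r" if "M \<ge> N" for M
  proof -
    have "norm (trunc M x - x) \<le> r / 2"
      using that N \<open>0 < r\<close> by (intro norm_c0_le) (auto intro!: less_imp_le)
    with \<open>0 < r\<close> show ?thesis by simp
  qed
  then show "\<exists>no. \<forall>n\<ge>no. norm (trunc n x - x) < r" by blast
qed

text \<open>Splitting off the last coordinate as a multiple of a unit vector reduces derivatives and
  limits of finitely supported points to an induction on \<open>N\<close>.\<close>

lemma initial_segment_Suc: "initial_segment (Suc N) z = initial_segment N z + c0_scaleC (z N) (initial_segment (Suc N) (\<lambda>n. of_bool (n = N)))"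
  by (rule c0_eqI) (auto simp: less_Suc_eq)

lemma initial_segment_0 [simp]: "initial_segment 0 z = 0"
  by (rule c0_eqI) auto

section \<open>Bounded holomorphic functions along complex curves\<close>

text \<open>The derivative of the curve is required in the complex linear form
  \<open>c0_scaleC h v\<close>. Complex linearity of \<open>D\<close> then turns the chain rule into
  multiplication by \<open>D v\<close>, which is a complex derivative.\<close>

lemma Hinf_curve:
  assumes "f \<in> Hinf" "(\<gamma> has_derivative (\<lambda>h. c0_scaleC h v)) (at \<zeta>)" "\<gamma> \<zeta> \<in> ball 0 1"
  shows "(\<lambda>\<zeta>. f (\<gamma> \<zeta>)) field_differentiable (at \<zeta>)"
proof -
  from assms obtain D where D: "(f has_derivative D) (at (\<gamma> \<zeta>))" "\<And>c h. D (c0_scaleC c h) = c * D h"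
    unfolding Hinf_def by blast
  have "((\<lambda>\<zeta>. f (\<gamma> \<zeta>)) has_derivative (\<lambda>h. D (c0_scaleC h v))) (at \<zeta>)"
    using diff_chain_at[OF assms(2) D(1)] by (simp add: o_def)
  then have "((\<lambda>\<zeta>. f (\<gamma> \<zeta>)) has_field_derivative D v) (at \<zeta>)"
    unfolding has_field_derivative_def by (rule has_derivative_eq_rhs) (auto simp: D(2))
  then show ?thesis unfolding field_differentiable_def by blast
qed

lemma has_derivative_line:
  "((\<lambda>\<zeta>. p + c0_scaleC \<zeta> d) has_derivative (\<lambda>h. c0_scaleC h d)) F"
  by (auto intro!: derivative_eq_intros bounded_linear.has_derivative[OF bounded_linear_c0_scaleC])

lemma Hinf_line:
  assumes "f \<in> Hinf" "\<And>\<zeta>. \<zeta> \<in> S \<Longrightarrow> norm (p + c0_scaleC \<zeta> d) < 1"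
  shows "(\<lambda>\<zeta>. f (p + c0_scaleC \<zeta> d)) holomorphic_on S"
  unfolding holomorphic_on_def
  using Hinf_curve[OF assms(1) has_derivative_line] assms(2)
  by (auto intro: field_differentiable_at_within)

lemma has_derivative_initial_segment:
  assumes "\<And>n. n < N \<Longrightarrow> (g n has_field_derivative g' n) (at \<zeta>)"
  shows "((\<lambda>\<zeta>. initial_segment N (\<lambda>n. g n \<zeta>)) has_derivative (\<lambda>h. c0_scaleC h (initial_segment N g'))) (at \<zeta>)"
  using assms
proof (induction N)
  case 0
  then show ?case by simp
next
  case (Suc N)
  let ?e = "initial_segment (Suc N) (\<lambda>n. of_bool (n = N))"
  have "((\<lambda>\<zeta>. c0_scaleC (g N \<zeta>) ?e) has_derivative (\<lambda>h. c0_scaleC (g' N * h) ?e)) (at \<zeta>)"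
    using Suc.prems[of N] unfolding has_field_derivative_def
    by (intro bounded_linear.has_derivative[OF bounded_linear_c0_scaleC]) auto
  then have "((\<lambda>\<zeta>. initial_segment N (\<lambda>n. g n \<zeta>) + c0_scaleC (g N \<zeta>) ?e) has_derivative
      (\<lambda>h. c0_scaleC h (initial_segment N g') + c0_scaleC (g' N * h) ?e)) (at \<zeta>)"
    using Suc.IH Suc.prems by (intro has_derivative_add) auto
  moreover have "c0_scaleC h (initial_segment N g') + c0_scaleC (g' N * h) ?e = c0_scaleC h (initial_segment (Suc N) g')" for h
    by (rule c0_eqI) (auto simp: less_Suc_eq)
  ultimately show ?case by (subst initial_segment_Suc) simp
qed

lemma norm_le_supnorm: "norm (f x) \<le> supnorm f" if "f \<in> Hinf" "norm x < 1"
proof -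
  have "bdd_above ((\<lambda>x. norm (f x)) ` ball 0 1)"
    using that(1) unfolding Hinf_def bounded_iff by (auto intro: bdd_aboveI2)
  then show ?thesis unfolding supnorm_def using that(2) by (intro cSUP_upper) auto
qed

lemma supnorm_le: "supnorm f \<le> B" if "\<And>x. norm x < 1 \<Longrightarrow> norm (f x) \<le> B"
  unfolding supnorm_def by (rule cSUP_least) (auto simp: that)


section \<open>Uniform approximation by truncations\<close>

text \<open>The variance identity: after expanding the square, the cross term integrates to twice
  the squared modulus of the mean.\<close>

lemma has_integral_norm_diff_mean:
  fixes \<phi> :: "real \<Rightarrow> complex"
  assumes "continuous_on {0..1} \<phi>" "(\<phi> has_integral m) {0..1}"
  shows "((\<lambda>t. (norm (\<phi> t - m))\<^sup>2) has_integral
    integral {0..1} (\<lambda>t. (norm (\<phi> t))\<^sup>2) - (norm m)\<^sup>2) {0..1}"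
proof -
  have "((\<lambda>t. Re (cnj m * \<phi> t)) has_integral Re (cnj m * m)) {0..1}"
    using has_integral_mult_right[OF assms(2), of "cnj m"] by (rule has_integral_Re)
  moreover have "((\<lambda>t. (norm (\<phi> t))\<^sup>2) has_integral integral {0..1} (\<lambda>t. (norm (\<phi> t))\<^sup>2)) {0..1}"
    using assms(1) by (intro integrable_integral integrable_continuous_interval continuous_intros)
  moreover have "((\<lambda>t::real. (norm m)\<^sup>2) has_integral (norm m)\<^sup>2) {0..1}"
    using has_integral_const_real[of "(norm m)\<^sup>2" 0 1] by simp
  ultimately have *: "((\<lambda>t. (norm (\<phi> t))\<^sup>2 - 2 * Re (cnj m * \<phi> t) + (norm m)\<^sup>2) has_integral
      (integral {0..1} (\<lambda>t. (norm (\<phi> t))\<^sup>2) - 2 * Re (cnj m * m) + (norm m)\<^sup>2)) {0..1}"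
    by (intro has_integral_add has_integral_diff has_integral_mult_right)
  have "(norm (\<phi> t))\<^sup>2 - 2 * Re (cnj m * \<phi> t) + (norm m)\<^sup>2 = (norm (\<phi> t - m))\<^sup>2" for t
    unfolding cmod_power2 by (simp add: algebra_simps power2_eq_square)
  moreover have "Re (cnj m * m) = (norm m)\<^sup>2"
    unfolding cmod_power2 by (simp add: power2_eq_square)
  ultimately show ?thesis using * by (simp only:) simp
qed

lemma norm_mean_squared_le:
  fixes \<phi> :: "real \<Rightarrow> complex"
  assumes "continuous_on {0..1} \<phi>" "(\<phi> has_integral m) {0..1}"
  shows "(norm m)\<^sup>2 \<le> integral {0..1} (\<lambda>t. (norm (\<phi> t))\<^sup>2)"
  using has_integral_nonneg[OF has_integral_norm_diff_mean[OF assms]] by simp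

text \<open>Radius 2 leaves room: increments will be taken between the parameters 0 and 1, and 1 has
  distance at least 1 from this circle.\<close>

abbreviation circ2 :: "real \<Rightarrow> complex"
  where "circ2 t \<equiv> 2 * exp (2 * of_real pi * \<i> * of_real t)"

lemma norm_circ2: "norm (circ2 t) = 2"
  by (simp add: norm_mult)

lemma continuous_on_circ2:
  assumes "continuous_on (cball 0 2) g"
  shows "continuous_on {0..1} (\<lambda>t. g (circ2 t))"
  by (rule continuous_on_compose2[OF assms]) (auto intro!: continuous_intros simp: norm_mult)

text \<open>Cauchy's integral formula, normalised to a mean over the unit interval. For
  \<open>w = 0\<close> the kernel is 1 and this is the mean value property.\<close>

lemma circle_mean:
  assumes "continuous_on (cball 0 2) g" "g holomorphic_on ball 0 2" "norm w < 2"
  shows "((\<lambda>t. g (circ2 t) * (circ2 t / (circ2 t - w))) has_integral g w) {0..1}"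
proof -
  have "((\<lambda>u. g u / (u - w)) has_contour_integral (2 * of_real pi * \<i> * g w)) (circlepath 0 2)"
    using Cauchy_integral_circlepath[OF assms(1,2)] assms(3) by simp
  then have "((\<lambda>t. g (circlepath 0 2 t) / (circlepath 0 2 t - w) * vector_derivative (circlepath 0 2) (at t))
      has_integral (2 * of_real pi * \<i> * g w)) {0..1}"
    unfolding has_contour_integral .
  then have "((\<lambda>t. inverse (2 * of_real pi * \<i>) * (g (circlepath 0 2 t) / (circlepath 0 2 t - w) * vector_derivative (circlepath 0 2) (at t)))
      has_integral inverse (2 * of_real pi * \<i>) * (2 * of_real pi * \<i> * g w)) {0..1}"
    by (rule has_integral_mult_right)
  moreover have "inverse (2 * of_real pi * \<i>) * (2 * of_real pi * \<i> * g w) = g w"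
    by (simp add: field_simps)
  moreover have "inverse (2 * of_real pi * \<i>) * (g (circlepath 0 2 t) / (circlepath 0 2 t - w) *
      vector_derivative (circlepath 0 2) (at t)) = g (circ2 t) * (circ2 t / (circ2 t - w))" for t
    unfolding vector_derivative_circlepath by (simp add: circlepath field_simps)
  ultimately show ?thesis by (simp only:)
qed

text \<open>For the second estimate, Cauchy's formula writes \<open>g 1 - g 0\<close> as the mean of
  \<open>g - g 0\<close> against a kernel of modulus at most 2. Hence its square is at most 4 times
  the variance of \<open>g\<close> on the circle, and the variance is the mean square minus the
  square of the mean \<open>g 0\<close>.\<close>

lemma mean_square_ge:
  assumes "continuous_on (cball 0 2) g" "g holomorphic_on ball 0 2"
  shows "(norm (g 0))\<^sup>2 \<le> integral {0..1} (\<lambda>t. (norm (g (circ2 t)))\<^sup>2)"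
    and "(norm (g 0))\<^sup>2 + (norm (g 1 - g 0))\<^sup>2 / 4 \<le> integral {0..1} (\<lambda>t. (norm (g (circ2 t)))\<^sup>2)"
proof -
  have c: "continuous_on {0..1} (\<lambda>t. g (circ2 t))"
    by (rule continuous_on_circ2[OF assms(1)])
  have m: "((\<lambda>t. g (circ2 t)) has_integral g 0) {0..1}"
    using circle_mean[OF assms, of 0] by simp
  show "(norm (g 0))\<^sup>2 \<le> integral {0..1} (\<lambda>t. (norm (g (circ2 t)))\<^sup>2)"
    by (rule norm_mean_squared_le[OF c m])
  let ?h = "\<lambda>z. g z - g 0" and ?k = "\<lambda>t. circ2 t / (circ2 t - 1)"
  have h: "((\<lambda>t. (norm (?h (circ2 t)))\<^sup>2) has_integral
    integral {0..1} (\<lambda>t. (norm (g (circ2 t)))\<^sup>2) - (norm (g 0))\<^sup>2) {0..1}"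
    by (rule has_integral_norm_diff_mean[OF c m])
  have ne: "circ2 t \<noteq> 1" for t
    by (metis norm_circ2 norm_one numeral_One numeral_eq_iff semiring_norm(83))
  have ck: "continuous_on {0..1} (\<lambda>t. ?h (circ2 t) * ?k t)"
    using c ne by (intro continuous_intros) auto
  have "((\<lambda>t. ?h (circ2 t) * ?k t) has_integral ?h 1) {0..1}"
    using assms by (intro circle_mean[of ?h 1]) (auto intro!: continuous_intros holomorphic_intros)
  then have "(norm (?h 1))\<^sup>2 \<le> integral {0..1} (\<lambda>t. (norm (?h (circ2 t) * ?k t))\<^sup>2)"
    using norm_mean_squared_le[OF ck] by simp
  also have "\<dots> \<le> integral {0..1} (\<lambda>t. 4 * (norm (?h (circ2 t)))\<^sup>2)"
  proof (rule integral_le)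
    show "(\<lambda>t. (norm (?h (circ2 t) * ?k t))\<^sup>2) integrable_on {0..1}"
      by (intro integrable_continuous_interval continuous_on_power continuous_on_norm ck)
    show "(\<lambda>t. 4 * (norm (?h (circ2 t)))\<^sup>2) integrable_on {0..1}"
      using c by (intro integrable_continuous_interval continuous_intros)
    fix t :: real
    have "norm (circ2 t - 1) \<ge> 1"
      using norm_triangle_ineq2[of "circ2 t" 1] norm_circ2[of t] by simp
    then have "norm (?k t) \<le> 2"
      by (simp add: norm_divide norm_circ2 divide_le_eq)
    then have "norm (?h (circ2 t) * ?k t) \<le> norm (?h (circ2 t)) * 2"
      unfolding norm_mult by (intro mult_left_mono) auto
    then have "(norm (?h (circ2 t) * ?k t))\<^sup>2 \<le> (norm (?h (circ2 t)) * 2)\<^sup>2"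
      by (intro power_mono) auto
    then show "(norm (?h (circ2 t) * ?k t))\<^sup>2 \<le> 4 * (norm (?h (circ2 t)))\<^sup>2"
      by (simp add: power_mult_distrib)
  qed
  also have "\<dots> = 4 * (integral {0..1} (\<lambda>t. (norm (g (circ2 t)))\<^sup>2) - (norm (g 0))\<^sup>2)"
    using integral_unique[OF h] by simp
  finally show "(norm (g 0))\<^sup>2 + (norm (g 1 - g 0))\<^sup>2 / 4 \<le> integral {0..1} (\<lambda>t. (norm (g (circ2 t)))\<^sup>2)"
    by simp
qed

text \<open>Bessel's inequality on the torus: the functions \<open>\<theta> \<mapsto> f (p + \<theta> k d k) - f p\<close> for different \<open>k\<close>
  are orthogonal. Taking the mean over one coordinate at a time avoids iterated integrals.\<close>

lemma bessel_blocks: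
  assumes "finite K" "f \<in> Hinf" "\<And>x. norm x < 1 \<Longrightarrow> norm (f x) \<le> C"
    and "\<And>\<theta>. (\<forall>k. norm (\<theta> k) \<le> 2) \<Longrightarrow> norm (p + (\<Sum>k\<in>K. c0_scaleC (\<theta> k) (d k))) < 1"
  shows "(norm (f p))\<^sup>2 + (\<Sum>k\<in>K. (norm (f (p + d k) - f p))\<^sup>2 / 4) \<le> C\<^sup>2"
  using assms(1,4)
proof (induction K arbitrary: p rule: finite_induct)
  case empty
  have "norm p < 1" using empty[of "\<lambda>_. 0"] by simp
  then have "(norm (f p))\<^sup>2 \<le> C\<^sup>2" using assms(3) by (intro power_mono) auto
  then show ?case by simp
next
  case (insert j K)
  have nb: "norm (p + c0_scaleC \<zeta> (d j) + (\<Sum>k\<in>K. c0_scaleC (\<theta> k) (d k))) < 1"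
    if "norm \<zeta> \<le> 2" "\<forall>k. norm (\<theta> k) \<le> 2" for \<zeta> \<theta>
  proof -
    have "(\<Sum>k\<in>K. c0_scaleC ((\<theta>(j := \<zeta>)) k) (d k)) = (\<Sum>k\<in>K. c0_scaleC (\<theta> k) (d k))"
      using insert(2) by (intro sum.cong) auto
    then show ?thesis using insert(4)[of "\<theta>(j := \<zeta>)"] insert(1,2) that by (auto simp: add.assoc)
  qed
  \<comment> \<open>The base value and the increments are followed along the block
    \<open>d j\<close>. The induction hypothesis bounds them together for each \<zeta> on the
    circle; taking the mean returns the values at 0 and gains the increment of
    \<open>g\<close>.\<close>
  define g where "g \<zeta> = f (p + c0_scaleC \<zeta> (d j))" for \<zeta>
  define G where "G k \<zeta> = f (p + d k + c0_scaleC \<zeta> (d j)) - f (p + c0_scaleC \<zeta> (d j))" for k \<zeta>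
  have "norm (p + c0_scaleC \<zeta> (d j)) < 1" if "norm \<zeta> \<le> 2" for \<zeta>
    using nb[OF that, of "\<lambda>_. 0"] by simp
  then have gh: "g holomorphic_on cball 0 2"
    unfolding g_def using assms(2) by (intro Hinf_line) auto
  have "norm (p + d k + c0_scaleC \<zeta> (d j)) < 1" if "norm \<zeta> \<le> 2" "k \<in> K" for \<zeta> k
  proof -
    have *: "(\<Sum>i\<in>K. c0_scaleC (of_bool (i = k)) (d i)) = (\<Sum>i\<in>K. if i = k then d i else 0)"
      by (intro sum.cong) auto
    show ?thesis using nb[OF that(1), of "\<lambda>i. of_bool (i = k)"] that(2) insert(1)
      by (simp add: * sum.delta algebra_simps)
  qed
  then have Gh: "G k holomorphic_on cball 0 2" if "k \<in> K" for k
    unfolding G_def using assms(2) that by (intro holomorphic_on_diff gh[unfolded g_def] Hinf_line) auto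
  have IH: "(norm (g \<zeta>))\<^sup>2 + (\<Sum>k\<in>K. (norm (G k \<zeta>))\<^sup>2 / 4) \<le> C\<^sup>2" if "norm \<zeta> \<le> 2" for \<zeta>
    using insert(3)[OF nb[OF that]] unfolding g_def G_def by (simp add: algebra_simps)
  have sq: "(\<lambda>t. (norm (h (circ2 t)))\<^sup>2) integrable_on {0..1}" if "h holomorphic_on cball 0 2" for h
    using continuous_on_circ2[OF holomorphic_on_imp_continuous_on[OF that]]
    by (intro integrable_continuous_interval continuous_intros)
  have "(norm (g 0))\<^sup>2 + (norm (g 1 - g 0))\<^sup>2 / 4 + (\<Sum>k\<in>K. (norm (G k 0))\<^sup>2 / 4)
      \<le> integral {0..1} (\<lambda>t. (norm (g (circ2 t)))\<^sup>2) + (\<Sum>k\<in>K. integral {0..1} (\<lambda>t. (norm (G k (circ2 t)))\<^sup>2) / 4)"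
    using holomorphic_on_subset[OF gh ball_subset_cball] holomorphic_on_subset[OF Gh ball_subset_cball]
    by (intro add_mono sum_mono divide_right_mono mean_square_ge)
      (auto intro: holomorphic_on_imp_continuous_on gh Gh)
  also have "\<dots> = integral {0..1} (\<lambda>t. (norm (g (circ2 t)))\<^sup>2 + (\<Sum>k\<in>K. (norm (G k (circ2 t)))\<^sup>2 / 4))"
    using sq[OF gh] sq[OF Gh] insert(1)
    by (simp add: integral_add integral_sum integrable_sum integrable_on_divide)
  also have "\<dots> \<le> integral {0..1} (\<lambda>t::real. C\<^sup>2)"
    using sq[OF gh] sq[OF Gh] insert(1) IH
    by (intro integral_le) (auto intro!: integrable_add integrable_sum integrable_on_divide simp: norm_circ2)
  finally show ?case
    using insert(1,2) unfolding g_def G_def by (simp add: algebra_simps)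
qed


text \<open>Rescaling reduces this to the unit disc. Enlarging \<open>B\<close> to \<open>E\<close>
  first makes the normalised values strictly less than 1 and covers \<open>B = 0\<close>; then
  \<open>E\<close> is moved down to \<open>B\<close>.\<close>

lemma Schwarz_bound:
  assumes "h holomorphic_on ball 0 R" "h 0 = 0" "\<And>z. norm z < R \<Longrightarrow> norm (h z) \<le> B" "norm \<xi> < R"
  shows "norm (h \<xi>) \<le> B * norm \<xi> / R"
proof -
  have R: "0 < R" using assms(4) norm_ge_zero[of \<xi>] by linarith
  have B: "0 \<le> B" using assms(3)[of 0] R assms(2) by simp
  have *: "norm (h \<xi>) \<le> E * norm \<xi> / R" if "B < E" for E
  proof -
    define k where "k z = h (of_real R * z) / of_real E" for z
    have pos: "0 < E" using B that by simp
    have "(h \<circ> (\<lambda>z. of_real R * z)) holomorphic_on ball 0 1"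
      using R by (intro holomorphic_on_compose_gen[OF _ assms(1)] holomorphic_intros) (auto simp: norm_mult)
    then have "k holomorphic_on ball 0 1"
      unfolding k_def using pos by (intro holomorphic_intros) (auto simp: o_def)
    moreover have "norm (k z) < 1" if "norm z < 1" for z
    proof -
      have "norm (h (of_real R * z)) \<le> B" using that R by (intro assms(3)) (simp add: norm_mult)
      then show ?thesis using pos \<open>B < E\<close> unfolding k_def norm_divide norm_of_real by (simp add: divide_less_eq)
    qed
    ultimately have "norm (k (\<xi> / of_real R)) \<le> norm (\<xi> / of_real R)"
      using assms(4) R k_def[of 0] assms(2) by (intro Schwarz_Lemma(1)) (auto simp: norm_divide)
    then show ?thesis using pos R unfolding k_def norm_divide norm_of_real by (simp add: field_simps)
  qed
  show ?thesis
  proof (rule field_le_epsilon)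
    fix e :: real assume "0 < e"
    have "norm (h \<xi>) \<le> (B + e) * norm \<xi> / R" using \<open>0 < e\<close> by (intro *) simp
    also have "\<dots> = B * norm \<xi> / R + e * (norm \<xi> / R)" by (simp add: algebra_simps add_divide_distrib)
    also have "\<dots> \<le> B * norm \<xi> / R + e * 1"
      using assms(4) R \<open>0 < e\<close> by (intro add_left_mono mult_left_mono) auto
    finally show "norm (h \<xi>) \<le> B * norm \<xi> / R + e" by simp
  qed
qed

section \<open>Points of \<open>c0\<close> with disjoint supports\<close>

definition disj_supp :: "c0 \<Rightarrow> c0 \<Rightarrow> bool"
  where "disj_supp x y \<longleftrightarrow> (\<forall>n. cc x n = 0 \<or> cc y n = 0)"

lemma disj_supp_add: "disj_supp x y \<Longrightarrow> disj_supp z y \<Longrightarrow> disj_supp (x + z) y"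
  unfolding disj_supp_def by (metis add_0 cc_simps(2))

lemma disj_supp_scaleC: "disj_supp x y \<Longrightarrow> disj_supp (c0_scaleC a x) y"
  by (auto simp: disj_supp_def)

lemma disj_supp_sym: "disj_supp x y \<Longrightarrow> disj_supp y x"
  by (auto simp: disj_supp_def)

text \<open>Each coordinate of the sum comes from one summand only. In the supremum norm, disjoint
  blocks can therefore be added without leaving the ball.\<close>

lemma norm_add_disj_supp_le: "norm (x + y) \<le> max (norm x) (norm y)" if "disj_supp x y"
proof (rule norm_c0_le)
  fix n
  show "norm (cc (x + y) n) \<le> max (norm x) (norm y)"
    using that norm_cc_le[of x n] norm_cc_le[of y n] unfolding disj_supp_def
    by (cases "cc x n = 0") (auto simp: le_max_iff_disj)
qed

lemma norm_add_disj_supp_less: "disj_supp x y \<Longrightarrow> norm x < r \<Longrightarrow> norm y < r \<Longrightarrow> norm (x + y) < r"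
  using norm_add_disj_supp_le[of x y] by auto

lemma norm_sum_disj_supp_le:
  assumes "finite K" "0 \<le> B" "\<And>i. i \<in> K \<Longrightarrow> norm (d i) \<le> B"
    and "\<And>i j. i \<in> K \<Longrightarrow> j \<in> K \<Longrightarrow> i \<noteq> j \<Longrightarrow> disj_supp (d i) (d j)"
  shows "norm (\<Sum>i\<in>K. d i) \<le> B"
  using assms
proof (induction K rule: finite_induct)
  case (insert j K)
  have "disj_supp (\<Sum>i\<in>K. d i) (d j)"
    unfolding disj_supp_def
  proof
    fix n
    have "(\<Sum>i\<in>K. cc (d i) n) = 0" if "cc (d j) n \<noteq> 0"
      using insert.prems(3) insert.hyps that unfolding disj_supp_def by (intro sum.neutral) blast
    then show "cc (\<Sum>i\<in>K. d i) n = 0 \<or> cc (d j) n = 0" by auto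
  qed
  then have "norm (d j + (\<Sum>i\<in>K. d i)) \<le> max (norm (d j)) (norm (\<Sum>i\<in>K. d i))"
    by (rule norm_add_disj_supp_le[OF disj_supp_sym])
  also have "\<dots> \<le> B" using insert by auto
  finally show ?case using insert.hyps by simp
qed simp

lemma Hinf_isCont: "isCont f x" if "f \<in> Hinf" "norm x < 1"
  using that unfolding Hinf_def by (auto dest!: bspec[of _ _ x] intro: has_derivative_continuous)

text \<open>Otherwise increments of a fixed size at \<open>p\<close> occur arbitrarily far out.
  Choosing many of them with disjoint supports makes the left side of \<open>bessel_blocks\<close>
  exceed the square of the supremum norm.\<close>

lemma asymptotically_constant:
  assumes f: "f \<in> Hinf" and p: "norm p \<le> 1/4" and "0 < \<eta>"
  shows "\<exists>L. \<forall>d. (\<forall>n<L. cc d n = 0) \<and> norm d \<le> 1/8 \<longrightarrow> norm (f (p + d) - f p) < \<eta>"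
proof (rule ccontr)
  assume "\<not> ?thesis"
  then have ex: "\<exists>d. (\<forall>n<L. cc d n = 0) \<and> norm d \<le> 1/8 \<and> \<eta> \<le> norm (f (p + d) - f p)" for L
    by (meson not_less)
  \<comment> \<open>Cutting \<open>d\<close> off at a large \<open>M\<close> makes the block
    finitely supported; by continuity of \<open>f\<close> at \<open>p + d\<close> at least half of
    the increment survives.\<close>
  have "\<exists>d M. (\<forall>n. n < L \<or> M \<le> n \<longrightarrow> cc d n = 0) \<and> L \<le> M \<and> norm d \<le> 1/8 \<and> \<eta> / 2 \<le> norm (f (p + d) - f p)" for L
  proof -
    from ex[of L] obtain d where d: "\<forall>n<L. cc d n = 0" "norm d \<le> 1/8" "\<eta> \<le> norm (f (p + d) - f p)"
      by blast
    have "norm (p + d) < 1" using norm_triangle_ineq[of p d] p d by linarith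
    then have "(\<lambda>M. f (p + trunc M d)) \<longlonglongrightarrow> f (p + d)"
      by (intro isCont_tendsto_compose[OF Hinf_isCont[OF f]] tendsto_intros trunc_tendsto)
    then have "(\<lambda>M. norm (f (p + trunc M d) - f p)) \<longlonglongrightarrow> norm (f (p + d) - f p)"
      by (intro tendsto_intros)
    then have "\<forall>\<^sub>F M in sequentially. \<eta> / 2 < norm (f (p + trunc M d) - f p)"
      using d(3) \<open>0 < \<eta>\<close> by (intro order_tendstoD) auto
    then have "\<forall>\<^sub>F M in sequentially. \<eta> / 2 < norm (f (p + trunc M d) - f p) \<and> L \<le> M"
      using eventually_ge_at_top eventually_conj by blast
    then obtain M where "\<eta> / 2 < norm (f (p + trunc M d) - f p)" "L \<le> M"
      by (auto simp: eventually_sequentially)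
    then show ?thesis using d(1,2) norm_trunc_le[of M d]
      by (intro exI[of _ "trunc M d"] exI[of _ M]) auto
  qed
  then have "\<forall>L. \<exists>d M. (\<forall>n. n < L \<or> M \<le> n \<longrightarrow> cc d n = 0) \<and> L \<le> M \<and> norm d \<le> 1/8 \<and>
      \<eta> / 2 \<le> norm (f (p + d) - f p)" by blast
  from choice[OF this] obtain D where "\<forall>L. \<exists>M. (\<forall>n. n < L \<or> M \<le> n \<longrightarrow> cc (D L) n = 0) \<and>
      L \<le> M \<and> norm (D L) \<le> 1/8 \<and> \<eta> / 2 \<le> norm (f (p + D L) - f p)" ..
  from choice[OF this] obtain M where D: "\<And>L n. n < L \<or> M L \<le> n \<Longrightarrow> cc (D L) n = 0" "\<And>L. L \<le> M L"
      "\<And>L. norm (D L) \<le> 1/8" "\<And>L. \<eta> / 2 \<le> norm (f (p + D L) - f p)"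
    by blast
  \<comment> \<open>The block \<open>D L\<close> is supported between \<open>L\<close> and
    \<open>M L\<close>, so iterating \<open>M\<close> starts each block where the preceding one
    ends.\<close>
  define l where "l k = (M ^^ k) 0" for k
  have mono: "mono l" unfolding l_def mono_iff_le_Suc using D(2) by simp
  have dj: "disj_supp (c0_scaleC a (D (l i))) (c0_scaleC b (D (l j)))" if "i < j" for a b i j
    unfolding disj_supp_def
  proof
    fix n
    have "M (l i) \<le> l j" using monoD[OF mono, of "Suc i" j] that by (simp add: l_def)
    then have "M (l i) \<le> n \<or> n < l j" by linarith
    then show "cc (c0_scaleC a (D (l i))) n = 0 \<or> cc (c0_scaleC b (D (l j))) n = 0"
      using D(1)[of n "l i"] D(1)[of n "l j"] by auto
  qed
  \<comment> \<open>Bessel's inequality multiplies the blocks, of norm at most 1/8, by factors up to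
    2. Their disjoint sum has norm at most 1/4, and so has \<open>p\<close>.\<close>
  have b: "norm (p + (\<Sum>k\<in>K. c0_scaleC (\<theta> k) (D (l k)))) < 1" if "finite K" "\<forall>k. norm (\<theta> k) \<le> 2" for K \<theta>
  proof -
    have "norm (\<Sum>k\<in>K. c0_scaleC (\<theta> k) (D (l k))) \<le> 1/4"
    proof (rule norm_sum_disj_supp_le[OF that(1)])
      fix i
      have "norm (\<theta> i) * norm (D (l i)) \<le> 2 * (1/8)"
        using that(2) D(3) by (intro mult_mono) auto
      then show "norm (c0_scaleC (\<theta> i) (D (l i))) \<le> 1/4"
        using norm_c0_scaleC_le[of "\<theta> i" "D (l i)"] by linarith
    next
      fix i j :: nat assume "i \<noteq> j"
      then show "disj_supp (c0_scaleC (\<theta> i) (D (l i))) (c0_scaleC (\<theta> j) (D (l j)))"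
        using dj disj_supp_sym by (metis nat_neq_iff)
    qed simp
    then show ?thesis using p norm_triangle_ineq[of p "\<Sum>k\<in>K. c0_scaleC (\<theta> k) (D (l k))"] by linarith
  qed
  have le: "real n * ((\<eta> / 2)\<^sup>2 / 4) \<le> (supnorm f)\<^sup>2" for n
  proof -
    have "real n * ((\<eta> / 2)\<^sup>2 / 4) \<le> (\<Sum>k<n. (norm (f (p + D (l k)) - f p))\<^sup>2 / 4)"
    proof -
      have "(\<eta> / 2)\<^sup>2 / 4 \<le> (norm (f (p + D (l k)) - f p))\<^sup>2 / 4" for k
        by (rule divide_right_mono[OF power_mono[OF D(4)]]) (use \<open>0 < \<eta>\<close> in simp_all)
      then show ?thesis using sum_bounded_below[of "{..<n}" "(\<eta> / 2)\<^sup>2 / 4"] by simp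
    qed
    also have "\<dots> \<le> (norm (f p))\<^sup>2 + \<dots>" by simp
    also have "\<dots> \<le> (supnorm f)\<^sup>2"
      using b by (intro bessel_blocks f norm_le_supnorm) auto
    finally show ?thesis .
  qed
  have "0 < (\<eta> / 2)\<^sup>2 / 4" using \<open>0 < \<eta>\<close> by simp
  from reals_Archimedean3[OF this, rule_format, of "(supnorm f)\<^sup>2"] le show False
    by (meson not_less)
qed

section \<open>Mixed differences over disjoint blocks\<close>

fun mixed_difference :: "(c0 \<Rightarrow> complex) \<Rightarrow> c0 list \<Rightarrow> c0 \<Rightarrow> complex"
  where "mixed_difference f [] p = f p"
  | "mixed_difference f (b # bs) p = mixed_difference f bs (p + b) - mixed_difference f bs p"

text \<open>Every point at which \<open>f\<close> is evaluated is
  \<open>p + c0_scaleC \<zeta> d\<close> plus some of the blocks; by disjointness all these points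
  stay in the open ball.\<close>

lemma mixed_difference_line_holomorphic:
  assumes "f \<in> Hinf" "\<And>\<zeta>. \<zeta> \<in> S \<Longrightarrow> norm (p + c0_scaleC \<zeta> d) < 1" "sorted_wrt disj_supp bs"
    "\<And>b. b \<in> set bs \<Longrightarrow> norm b < 1 \<and> disj_supp p b \<and> disj_supp d b"
  shows "(\<lambda>\<zeta>. mixed_difference f bs (p + c0_scaleC \<zeta> d)) holomorphic_on S"
  using assms(2-)
proof (induction bs arbitrary: p)
  case Nil
  then show ?case using Hinf_line[OF assms(1), of S p d] by simp
next
  case (Cons b bs)
  have 1: "p + c0_scaleC \<zeta> d + b = p + b + c0_scaleC \<zeta> d" for \<zeta> by simp
  have "norm (p + b + c0_scaleC \<zeta> d) < 1" if "\<zeta> \<in> S" for \<zeta>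
    unfolding 1[symmetric] using Cons.prems(1)[OF that] Cons.prems(3)[of b]
    by (auto intro!: norm_add_disj_supp_less[of "p + c0_scaleC \<zeta> d" b] disj_supp_add[of p] disj_supp_scaleC)
  then have "(\<lambda>\<zeta>. mixed_difference f bs (p + b + c0_scaleC \<zeta> d)) holomorphic_on S"
    using Cons.prems(2,3) by (intro Cons.IH) (auto intro: disj_supp_add)
  moreover have "(\<lambda>\<zeta>. mixed_difference f bs (p + c0_scaleC \<zeta> d)) holomorphic_on S"
    using Cons.prems by (intro Cons.IH) auto
  ultimately show ?case by (simp add: 1 holomorphic_on_diff)
qed

text \<open>Each block gains a factor 1/4. A block of norm at most 1/8 may be multiplied by any
  parameter of modulus less than 8, and on that disc the difference in its direction vanishes at 0
  and is at most twice the bound for the remaining blocks. The Schwarz lemma at the parameter 1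
  contributes the factor 1/8.\<close>

lemma norm_mixed_difference_le:
  assumes "f \<in> Hinf" "\<And>x. norm x < 1 \<Longrightarrow> norm (f x) \<le> C" "norm p < 1" "sorted_wrt disj_supp (p # bs)"
    "\<And>b. b \<in> set bs \<Longrightarrow> norm b \<le> 1/8"
  shows "norm (mixed_difference f bs p) \<le> C * (1/4) ^ length bs"
  using assms(3-)
proof (induction bs arbitrary: p)
  case Nil
  then show ?case using assms(2) by simp
next
  case (Cons b bs)
  have nb: "norm (p + c0_scaleC \<zeta> b) < 1" if "norm \<zeta> < 8" for \<zeta>
  proof -
    have "norm \<zeta> * norm b \<le> norm \<zeta> * (1/8)" using Cons.prems(3)[of b] by (intro mult_left_mono) auto
    then have "norm (c0_scaleC \<zeta> b) < 1" using norm_c0_scaleC_le[of \<zeta> b] that by linarith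
    then show ?thesis using Cons.prems(1,2)
      by (intro norm_add_disj_supp_less disj_supp_sym[OF disj_supp_scaleC]) (auto intro: disj_supp_sym)
  qed
  let ?h = "\<lambda>\<zeta>. mixed_difference f bs (p + c0_scaleC \<zeta> b) - mixed_difference f bs p"
  have "norm (?h 1) \<le> (2 * (C * (1/4) ^ length bs)) * norm (1::complex) / 8"
  proof (rule Schwarz_bound)
    have "norm x < 1" if "x \<in> set bs" for x using Cons.prems(3)[of x] that by simp
    then show "?h holomorphic_on ball 0 8"
      using Cons.prems(2) nb by (intro holomorphic_intros mixed_difference_line_holomorphic assms(1)) auto
    fix \<zeta> :: complex assume \<zeta>: "norm \<zeta> < 8"
    have "norm (mixed_difference f bs (p + c0_scaleC \<zeta> b)) \<le> C * (1/4) ^ length bs"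
      using Cons.prems nb[OF \<zeta>] by (intro Cons.IH) (auto intro!: disj_supp_add[OF _ disj_supp_scaleC])
    moreover have "norm (mixed_difference f bs p) \<le> C * (1/4) ^ length bs"
      using Cons.prems by (intro Cons.IH) auto
    ultimately show "norm (?h \<zeta>) \<le> 2 * (C * (1/4) ^ length bs)"
      using norm_triangle_ineq4[of "mixed_difference f bs (p + c0_scaleC \<zeta> b)" "mixed_difference f bs p"] by linarith
  qed simp_all
  then show ?case by simp
qed

text \<open>The mixed difference is a signed sum of \<open>2 ^ length bs\<close> values of
  \<open>f\<close>, and moving the base point changes each of them by at most \<omega>.\<close>

lemma norm_mixed_difference_diff_le:
  assumes "\<And>x y. norm x < 1 \<Longrightarrow> norm y < 1 \<Longrightarrow> dist x y < \<delta> \<Longrightarrow> dist (f x) (f y) \<le> \<omega>"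
    and "norm p < 1" "norm q < 1" "dist p q < \<delta>" "sorted_wrt disj_supp (p # bs)" "sorted_wrt disj_supp (q # bs)"
    "\<And>b. b \<in> set bs \<Longrightarrow> norm b < 1"
  shows "norm (mixed_difference f bs p - mixed_difference f bs q) \<le> 2 ^ length bs * \<omega>"
  using assms(2-)
proof (induction bs arbitrary: p q)
  case Nil
  then show ?case using assms(1)[of p q] by (simp add: dist_norm)
next
  case (Cons b bs)
  have "norm (mixed_difference f bs (p + b) - mixed_difference f bs (q + b)) \<le> 2 ^ length bs * \<omega>"
    using Cons.prems by (intro Cons.IH) (auto intro: disj_supp_add norm_add_disj_supp_less)
  moreover have "norm (mixed_difference f bs p - mixed_difference f bs q) \<le> 2 ^ length bs * \<omega>"
    using Cons.prems by (intro Cons.IH) auto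
  moreover have "norm (mixed_difference f (b # bs) p - mixed_difference f (b # bs) q) \<le>
      norm (mixed_difference f bs (p + b) - mixed_difference f bs (q + b)) + norm (mixed_difference f bs p - mixed_difference f bs q)"
    using norm_triangle_ineq4[of "mixed_difference f bs (p + b) - mixed_difference f bs (q + b)" "mixed_difference f bs p - mixed_difference f bs q"]
    by (simp add: algebra_simps)
  ultimately show ?case by simp
qed

text \<open>Each of the \<open>2 ^ length bs\<close> terms is within \<eta> of \<open>f q\<close>,
  and these copies of \<open>f q\<close> cancel as soon as there is a block. The vector
  \<open>t\<close> collects the blocks already added in the induction.\<close>

lemma norm_mixed_difference_le_asymptotic:
  assumes "\<And>d. (\<forall>n<L. cc d n = 0) \<Longrightarrow> norm d \<le> 1/8 \<Longrightarrow> norm (f (q + d) - f q) \<le> \<eta>"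
    and "\<forall>n<L. cc t n = 0" "norm t \<le> 1/8" "sorted_wrt disj_supp (t # bs)"
    "\<And>b. b \<in> set bs \<Longrightarrow> norm b \<le> 1/8 \<and> (\<forall>n<L. cc b n = 0)"
  shows "norm (mixed_difference f bs (q + t) - (if bs = [] then f q else 0)) \<le> 2 ^ length bs * \<eta>"
  using assms(2-)
proof (induction bs arbitrary: t)
  case Nil
  then show ?case using assms(1)[of t] by simp
next
  case (Cons b bs)
  let ?c = "if bs = [] then f q else 0"
  have "norm (t + b) \<le> 1/8"
    using norm_add_disj_supp_le[of t b] Cons.prems(2,3) Cons.prems(4)[of b] by auto
  then have "norm (mixed_difference f bs (q + (t + b)) - ?c) \<le> 2 ^ length bs * \<eta>"
    using Cons.prems by (intro Cons.IH) (auto intro: disj_supp_add)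
  moreover have "norm (mixed_difference f bs (q + t) - ?c) \<le> 2 ^ length bs * \<eta>"
    using Cons.prems by (intro Cons.IH) auto
  moreover have "norm (mixed_difference f (b # bs) (q + t)) \<le>
      norm (mixed_difference f bs (q + (t + b)) - ?c) + norm (mixed_difference f bs (q + t) - ?c)"
    using norm_triangle_ineq4[of "mixed_difference f bs (q + (t + b)) - ?c" "mixed_difference f bs (q + t) - ?c"]
    by (simp add: algebra_simps)
  ultimately show ?case by simp
qed


section \<open>Raising the order of large mixed differences\<close>

lemma Au_imp_Hinf: "f \<in> Au \<Longrightarrow> f \<in> Hinf"
  by (simp add: Au_def)

lemma Au_uniformly_continuous:
  assumes "f \<in> Au" "0 < e"
  obtains d where "0 < d" "\<And>x y. norm x < 1 \<Longrightarrow> norm y < 1 \<Longrightarrow> dist x y < d \<Longrightarrow> dist (f x) (f y) < e"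
proof -
  have "uniformly_continuous_on (ball 0 1) f" using assms(1) by (simp add: Au_def)
  then obtain d where "0 < d" "\<forall>x\<in>ball 0 1. \<forall>y\<in>ball 0 1. dist y x < d \<longrightarrow> dist (f y) (f x) < e"
    using assms(2) unfolding uniformly_continuous_on_def by blast
  then show ?thesis by (intro that[of d]) auto
qed

lemma norm_diff_trunc_le: "norm (x - trunc N x) \<le> norm x"
  by (rule norm_c0_le) (simp add: norm_cc_le)

text \<open>Total boundedness in finitely many coordinates, built from a finite net of a complex
  disc for each coordinate. It lets one threshold serve for all base points, up to a small
  error.\<close>

lemma finite_net_initial_segment:
  assumes "0 < \<delta>"
  shows "\<exists>F. finite F \<and> (\<forall>p. norm p \<le> 1/8 \<longrightarrow>
    (\<exists>q\<in>F. dist (trunc N p) q < \<delta> \<and> (\<forall>n\<ge>N. cc q n = 0)))"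
  using assms
proof (induction N arbitrary: \<delta>)
  case 0
  then show ?case by (intro exI[of _ "{0}"]) auto
next
  case (Suc N)
  let ?e = "initial_segment (Suc N) (\<lambda>n. of_bool (n = N))"
  have e: "norm ?e \<le> 1" by (rule norm_initial_segment_le) auto
  obtain F where F: "finite F" "\<And>p. norm p \<le> 1/8 \<Longrightarrow> \<exists>q\<in>F. dist (trunc N p) q < \<delta> / 2 \<and> (\<forall>n\<ge>N. cc q n = 0)"
    using Suc.IH[of "\<delta> / 2"] Suc.prems by auto
  obtain G where G: "finite G" "cball (0::complex) (1/8) \<subseteq> (\<Union>c\<in>G. ball c (\<delta> / 2))"
    using Suc.prems compact_cball[of "0::complex" "1/8"] unfolding compact_eq_totally_bounded
    by (meson half_gt_zero)
  show ?case
  proof (intro exI[of _ "(\<lambda>(q, c). q + c0_scaleC c ?e) ` (F \<times> G)"] conjI allI impI)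
    show "finite ((\<lambda>(q, c). q + c0_scaleC c ?e) ` (F \<times> G))" using F(1) G(1) by simp
    fix p :: c0 assume p: "norm p \<le> 1/8"
    obtain q where q: "q \<in> F" "dist (trunc N p) q < \<delta> / 2" "\<forall>n\<ge>N. cc q n = 0"
      using F(2)[OF p] by blast
    have "cc p N \<in> cball 0 (1/8)" using norm_cc_le[of p N] p by simp
    then obtain c where c: "c \<in> G" "dist c (cc p N) < \<delta> / 2"
      using G(2) by (meson UN_E mem_ball subsetD)
    have *: "trunc (Suc N) p - (q + c0_scaleC c ?e) = (trunc N p - q) + c0_scaleC (cc p N - c) ?e"
      by (rule c0_eqI) (auto simp: less_Suc_eq)
    have "norm (c0_scaleC (cc p N - c) ?e) < \<delta> / 2"
    proof -
      have "norm (c0_scaleC (cc p N - c) ?e) \<le> norm (cc p N - c) * 1"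
        using norm_c0_scaleC_le e by (meson mult_left_mono norm_ge_zero order_trans)
      then show ?thesis using c(2) by (simp add: dist_norm norm_minus_commute)
    qed
    then have "dist (trunc (Suc N) p) (q + c0_scaleC c ?e) < \<delta>"
      using q(2) norm_triangle_ineq[of "trunc N p - q" "c0_scaleC (cc p N - c) ?e"]
      unfolding dist_norm * by linarith
    then show "\<exists>q\<in>(\<lambda>(q, c). q + c0_scaleC c ?e) ` (F \<times> G).
        dist (trunc (Suc N) p) q < \<delta> \<and> (\<forall>n\<ge>Suc N. cc q n = 0)"
      using q c by (intro bexI[of _ "q + c0_scaleC c ?e"]) auto
  qed
qed

text \<open>The mixed difference stays at least \<open>\<epsilon>\<close> no matter how far out the blocks have to be supported;
  the base point \<open>p\<close> may change with \<open>N\<close>.\<close>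

definition large_difference :: "(c0 \<Rightarrow> complex) \<Rightarrow> nat \<Rightarrow> real \<Rightarrow> bool"
  where "large_difference f m \<epsilon> \<longleftrightarrow> (\<forall>N. \<exists>p bs. length bs = m \<and> norm p \<le> 1/8 \<and> sorted_wrt disj_supp (p # bs) \<and>
    (\<forall>b\<in>set bs. norm b \<le> 1/8 \<and> (\<forall>n<N. cc b n = 0)) \<and> \<epsilon> \<le> norm (mixed_difference f bs p))"

text \<open>The part of the base point \<open>p\<close> beyond \<open>N\<close> becomes the new
  block. With base point \<open>trunc N p\<close> the old difference is small, since that point is
  close to a net point around which \<open>f\<close> hardly changes far out; so the large difference
  at \<open>p\<close> must come from the new block. The assumption \<open>0 < m\<close> excludes the
  empty list, whose difference is a value of \<open>f\<close> and need not be small.\<close>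

lemma large_difference_Suc:
  assumes f: "f \<in> Au" and Q: "large_difference f m \<epsilon>" and "0 < m" "\<epsilon>' < \<epsilon>"
  shows "large_difference f (Suc m) \<epsilon>'"
  unfolding large_difference_def
proof
  fix N
  \<comment> \<open>Two errors of size \<open>2 ^ m * \<eta>\<close> occur, one from moving to the
    net point and one from the near constancy there; together they use up
    \<open>\<epsilon> - \<epsilon>'\<close>.\<close>
  define \<eta> where "\<eta> = (\<epsilon> - \<epsilon>') / (2 * 2 ^ m)"
  have \<eta>: "0 < \<eta>" "2 ^ m * \<eta> + 2 ^ m * \<eta> = \<epsilon> - \<epsilon>'" using assms(4) by (auto simp: \<eta>_def)
  obtain d where d: "0 < d" "\<And>x y. norm x < 1 \<Longrightarrow> norm y < 1 \<Longrightarrow> dist x y < d \<Longrightarrow> dist (f x) (f y) < \<eta>"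
    using Au_uniformly_continuous[OF f \<eta>(1)] by metis
  \<comment> \<open>The bound 1/8 keeps the net point used within radius 1/4, where
    \<open>asymptotically_constant\<close> applies.\<close>
  define d' where "d' = min d (1/8)"
  have d': "0 < d'" "d' \<le> d" "d' \<le> 1/8" using d(1) by (auto simp: d'_def)
  obtain F where F: "finite F" "\<And>p. norm p \<le> 1/8 \<Longrightarrow> \<exists>q\<in>F. dist (trunc N p) q < d' \<and> (\<forall>n\<ge>N. cc q n = 0)"
    using finite_net_initial_segment[OF d'(1), of N] by blast
  have "\<forall>q. \<exists>L. norm q \<le> 1/4 \<longrightarrow> (\<forall>d. (\<forall>n<L. cc d n = 0) \<and> norm d \<le> 1/8 \<longrightarrow> norm (f (q + d) - f q) < \<eta>)"
    using asymptotically_constant[OF Au_imp_Hinf[OF f] _ \<eta>(1)] by blast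
  from choice[OF this] obtain L where
    L: "\<And>q d. norm q \<le> 1/4 \<Longrightarrow> \<forall>n<L q. cc d n = 0 \<Longrightarrow> norm d \<le> 1/8 \<Longrightarrow> norm (f (q + d) - f q) < \<eta>"
    by blast
  \<comment> \<open>The blocks have to be chosen before it is known which net point is close to the
    base point, so \<open>K\<close> exceeds the thresholds of all of them.\<close>
  define K where "K = N + sum L F"
  have K: "N \<le> K" "L q \<le> K" if "q \<in> F" for q
    using member_le_sum[of q F L] F(1) that by (auto simp: K_def)
  obtain p bs where p: "length bs = m" "norm p \<le> 1/8" "sorted_wrt disj_supp (p # bs)"
    "\<And>b. b \<in> set bs \<Longrightarrow> norm b \<le> 1/8" "\<And>b n. b \<in> set bs \<Longrightarrow> n < K \<Longrightarrow> cc b n = 0" "\<epsilon> \<le> norm (mixed_difference f bs p)"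
    using Q unfolding large_difference_def by metis
  define r where "r = p - trunc N p"
  obtain q where q: "q \<in> F" "dist (trunc N p) q < d'" "\<forall>n\<ge>N. cc q n = 0"
    using F(2)[OF p(2)] by blast
  have tp: "norm (trunc N p) \<le> 1/8" using norm_trunc_le[of N p] p(2) by simp
  have nr: "norm r \<le> 1/8"
    unfolding r_def using norm_diff_trunc_le[of p N] p(2) by simp
  have nq: "norm q \<le> 1/4"
    using tp q(2) d'(3) norm_triangle_ineq2[of q "trunc N p"] by (simp add: dist_norm norm_minus_commute)
  have sp: "\<forall>b\<in>set bs. disj_supp (trunc N p) b" "\<forall>b\<in>set bs. disj_supp r b"
    using p(3) unfolding r_def disj_supp_def by auto
  have sq: "\<forall>b\<in>set bs. disj_supp q b" unfolding disj_supp_def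
    using p(5) q(3) K(1)[OF q(1)] by (metis not_less order.strict_trans2)
  have sr: "disj_supp (trunc N p) r" unfolding r_def disj_supp_def by auto
  have "norm (mixed_difference f bs (trunc N p) - mixed_difference f bs q) \<le> 2 ^ length bs * \<eta>"
  proof (rule norm_mixed_difference_diff_le)
    show "dist (f x) (f y) \<le> \<eta>" if "norm x < 1" "norm y < 1" "dist x y < d'" for x y
      using d(2)[OF that(1,2)] that(3) d'(2) by simp
    show "norm (trunc N p) < 1" "norm q < 1" using tp nq by auto
    show "dist (trunc N p) q < d'" by (rule q(2))
    show "sorted_wrt disj_supp (trunc N p # bs)" "sorted_wrt disj_supp (q # bs)" using p(3) sp sq by auto
    show "norm b < 1" if "b \<in> set bs" for b using p(4)[OF that] by simp
  qed
  moreover have bs: "bs \<noteq> []" using p(1) assms(3) by auto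
  moreover have "norm (mixed_difference f bs (q + 0) - (if bs = [] then f q else 0)) \<le> 2 ^ length bs * \<eta>"
  proof (rule norm_mixed_difference_le_asymptotic)
    show "norm (f (q + d) - f q) \<le> \<eta>" if "\<forall>n<L q. cc d n = 0" "norm d \<le> 1/8" for d
      using L[OF nq that] by simp
    show "sorted_wrt disj_supp (0 # bs)" using p(3) by (simp add: disj_supp_def)
    show "norm b \<le> 1/8 \<and> (\<forall>n<L q. cc b n = 0)" if "b \<in> set bs" for b
      using p(4,5)[OF that] K(2)[OF q(1)] by auto
  qed auto
  ultimately have "norm (mixed_difference f bs (trunc N p)) \<le> \<epsilon> - \<epsilon>'"
    using \<eta>(2) norm_triangle_ineq2[of "mixed_difference f bs (trunc N p)" "mixed_difference f bs q"]
    unfolding p(1) if_not_P[OF bs] diff_zero add_0_right by linarith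
  then have "\<epsilon>' \<le> norm (mixed_difference f bs p - mixed_difference f bs (trunc N p))"
    using p(6) norm_triangle_ineq2[of "mixed_difference f bs p" "mixed_difference f bs (trunc N p)"] by linarith
  moreover have "mixed_difference f (r # bs) (trunc N p) = mixed_difference f bs p - mixed_difference f bs (trunc N p)" by (simp add: r_def)
  ultimately have "\<epsilon>' \<le> norm (mixed_difference f (r # bs) (trunc N p))" by (simp only:)
  moreover have "\<forall>b\<in>set (r # bs). norm b \<le> 1/8 \<and> (\<forall>n<N. cc b n = 0)"
    using nr p(4,5) K(1)[OF q(1)] by (auto simp: r_def)
  moreover have "sorted_wrt disj_supp (trunc N p # r # bs)"
    using sp sr p(3) by auto
  ultimately show "\<exists>p bs. length bs = Suc m \<and> norm p \<le> 1/8 \<and> sorted_wrt disj_supp (p # bs) \<and>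
    (\<forall>b\<in>set bs. norm b \<le> 1/8 \<and> (\<forall>n<N. cc b n = 0)) \<and> \<epsilon>' \<le> norm (mixed_difference f bs p)"
    using tp p(1) by (intro exI[of _ "trunc N p"] exI[of _ "r # bs"]) auto
qed

lemma trunc_uniform_small_ball:
  assumes f: "f \<in> Au" and "0 < \<epsilon>"
  shows "\<exists>N. \<forall>M\<ge>N. \<forall>x. norm x \<le> 1/8 \<longrightarrow> norm (f x - f (trunc M x)) < \<epsilon>"
proof (rule ccontr)
  assume neg: "\<not> ?thesis"
  have "large_difference f 1 \<epsilon>"
    unfolding large_difference_def
  proof
    fix N
    from neg obtain M x where M: "N \<le> M" "norm x \<le> 1/8" "\<epsilon> \<le> norm (f x - f (trunc M x))"
      by (meson not_less)
    have "norm (x - trunc M x) \<le> 1/8"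
      using norm_diff_trunc_le[of x M] M(2) by simp
    then show "\<exists>p bs. length bs = 1 \<and> norm p \<le> 1/8 \<and> sorted_wrt disj_supp (p # bs) \<and>
      (\<forall>b\<in>set bs. norm b \<le> 1/8 \<and> (\<forall>n<N. cc b n = 0)) \<and> \<epsilon> \<le> norm (mixed_difference f bs p)"
      using M norm_trunc_le[of M x]
      by (intro exI[of _ "trunc M x"] exI[of _ "[x - trunc M x]"]) (auto simp: disj_supp_def)
  qed
  \<comment> \<open>Halving the excess over \<open>\<epsilon> / 2\<close> at each order gives the
    strict loss that \<open>large_difference_Suc\<close> asks for, and \<open>\<epsilon> / 2\<close>
    is kept at every order.\<close>
  then have *: "large_difference f (Suc m) (\<epsilon> / 2 + \<epsilon> / 2 ^ Suc m)" for m
  proof (induction m)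
    case (Suc m)
    have "\<epsilon> / 2 ^ Suc (Suc m) < \<epsilon> / 2 ^ Suc m"
      using \<open>0 < \<epsilon>\<close> by (intro divide_strict_left_mono power_strict_increasing) auto
    then show ?case using Suc by (intro large_difference_Suc[OF f Suc.IH]) auto
  qed simp
  have le: "\<epsilon> / 2 \<le> supnorm f * (1/4) ^ Suc m" for m
  proof -
    obtain p bs where p: "length bs = Suc m" "norm p \<le> 1/8" "sorted_wrt disj_supp (p # bs)"
      "\<forall>b\<in>set bs. norm b \<le> 1/8" "\<epsilon> / 2 + \<epsilon> / 2 ^ Suc m \<le> norm (mixed_difference f bs p)"
      using *[of m] unfolding large_difference_def by metis
    have "norm (mixed_difference f bs p) \<le> supnorm f * (1/4) ^ length bs"
      using p by (intro norm_mixed_difference_le Au_imp_Hinf[OF f] norm_le_supnorm) auto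
    moreover have "0 \<le> \<epsilon> / 2 ^ Suc m" using \<open>0 < \<epsilon>\<close> by simp
    ultimately show ?thesis using p by simp
  qed
  have "(\<lambda>m. supnorm f * (1/4) ^ Suc m) \<longlonglongrightarrow> supnorm f * 0"
    by (intro tendsto_mult tendsto_const LIMSEQ_Suc LIMSEQ_power_zero) simp
  then have "\<epsilon> / 2 \<le> supnorm f * 0"
    by (rule LIMSEQ_le_const) (use le in blast)
  with \<open>0 < \<epsilon>\<close> show False by simp
qed

text \<open>Split the power series of \<open>h\<close> at 0. Cauchy's estimate on a circle of radius
  between \<open>r\<close> and 1 makes the tail small in terms of \<open>C\<close>; on the circle of
  radius 1/8 it makes the finitely many remaining terms small in terms of \<eta>. The choice of
  \<eta> does not depend on \<open>h\<close>.\<close>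

lemma holomorphic_small_on_small_disc:
  assumes "0 < r" "r < 1" "0 \<le> C" "0 < \<epsilon>"
  shows "\<exists>\<eta>>0. \<forall>h. h holomorphic_on ball 0 1 \<longrightarrow> (\<forall>z. norm z < 1 \<longrightarrow> norm (h z) \<le> C) \<longrightarrow>
    (\<forall>z. norm z \<le> 1/8 \<longrightarrow> norm (h z) \<le> \<eta>) \<longrightarrow> norm (h (of_real r)) < (\<epsilon>::real)"
proof -
  define R where "R = (1 + r) / 2"
  define q where "q = r / R"
  have R: "0 < R" "R < 1" "r < R" using assms by (auto simp: R_def)
  then have q: "0 < q" "q < 1" using assms by (auto simp: q_def)
  have "(\<lambda>K. C * q ^ K / (1 - q)) \<longlonglongrightarrow> C * 0 / (1 - q)"
    using q by (intro tendsto_intros LIMSEQ_power_zero) auto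
  then obtain K where K: "C * q ^ K / (1 - q) < \<epsilon> / 2"
    using order_tendstoD(2)[of _ _ sequentially "\<epsilon> / 2"] assms(4) by (fastforce simp: eventually_sequentially)
  \<comment> \<open>The terms of index \<open>n < K\<close> are at most
    \<open>8 ^ n * \<eta>\<close>, so together they are at most \<open>\<epsilon> / 2\<close>; the
    summand 1 keeps the denominator positive when \<open>K = 0\<close>.\<close>
  define \<eta> where "\<eta> = \<epsilon> / 2 / ((\<Sum>n<K. 8 ^ n) + 1)"
  have S: "0 \<le> (\<Sum>n<K. (8::real) ^ n)" by (intro sum_nonneg) auto
  have \<eta>: "0 < \<eta>" "(\<Sum>n<K. 8 ^ n) * \<eta> \<le> \<epsilon> / 2" using S assms(4) by (auto simp: \<eta>_def field_simps)
  have "norm (h (of_real r)) < \<epsilon>"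
    if h: "h holomorphic_on ball 0 1" "\<And>z. norm z < 1 \<Longrightarrow> norm (h z) \<le> C" "\<And>z. norm z \<le> 1/8 \<Longrightarrow> norm (h z) \<le> \<eta>" for h
  proof -
    define b where "b n = (deriv ^^ n) h 0 / fact n * (of_real r - 0) ^ n" for n
    have sums: "b sums h (of_real r)"
      unfolding b_def using assms by (intro holomorphic_power_series[OF h(1)]) auto
    have cauchy: "norm (b n) \<le> B * (r / s) ^ n" if "0 < s" "s < 1" "\<And>z. norm z = s \<Longrightarrow> norm (h z) \<le> B" for s B n
    proof -
      have "h holomorphic_on cball 0 s" using that(2) by (intro holomorphic_on_subset[OF h(1)]) auto
      then have "norm ((deriv ^^ n) h 0) \<le> fact n * B / s ^ n"
        using that by (intro Cauchy_inequality) (auto intro: holomorphic_on_imp_continuous_on holomorphic_on_subset)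
      then have "norm ((deriv ^^ n) h 0) / fact n \<le> B / s ^ n"
        by (simp add: field_simps)
      then have "norm ((deriv ^^ n) h 0) / fact n * r ^ n \<le> B / s ^ n * r ^ n"
        using assms(1) by (intro mult_right_mono) auto
      then show ?thesis using assms(1) by (simp add: b_def norm_mult norm_divide norm_power power_divide)
    qed
    have b1: "norm (b n) \<le> C * q ^ n" for n
      unfolding q_def using R h(2) by (intro cauchy) auto
    have b2: "norm (b n) \<le> 8 ^ n * \<eta>" for n
    proof -
      have "norm (b n) \<le> \<eta> * (r / (1/8)) ^ n" using h(3) by (intro cauchy) auto
      also have "\<dots> \<le> \<eta> * 8 ^ n" using \<eta>(1) assms by (intro mult_left_mono power_mono) auto
      finally show ?thesis by (simp add: mult.commute)
    qed
    have geo: "(\<lambda>n. C * q ^ (n + K)) sums (C * q ^ K * (1 / (1 - q)))"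
      using sums_mult[OF geometric_sums[of q], of "C * q ^ K"] q by (simp add: power_add mult_ac)
    have "norm (\<Sum>n. b (n + K)) \<le> C * q ^ K / (1 - q)"
      using norm_suminf_le[OF b1 sums_summable[OF geo]] sums_unique[OF geo] by simp
    moreover have "norm (\<Sum>n<K. b n) \<le> \<epsilon> / 2"
      using sum_norm_le[of "{..<K}" b "\<lambda>n. 8 ^ n * \<eta>"] b2 \<eta>(2) by (simp flip: sum_distrib_right)
    moreover have "h (of_real r) = (\<Sum>n. b (n + K)) + (\<Sum>n<K. b n)"
      using suminf_split_initial_segment[OF sums_summable[OF sums], of K] sums_unique[OF sums] by simp
    then have "norm (h (of_real r)) \<le> norm (\<Sum>n. b (n + K)) + norm (\<Sum>n<K. b n)"
      by (simp only: norm_triangle_ineq)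
    ultimately show ?thesis using K by linarith
  qed
  with \<eta>(1) show ?thesis by blast
qed

text \<open>By uniform continuity \<open>x\<close> and its truncation may be multiplied by a fixed
  \<open>r\<close> slightly below 1. Along the complex line through \<open>x\<close> the error of
  truncation is a bounded holomorphic function on the unit disc that is small for parameters of
  modulus at most 1/8, hence also at \<open>r\<close>.\<close>

proposition trunc_uniform:
  assumes f: "f \<in> Au" and "0 < \<epsilon>"
  shows "\<exists>N. \<forall>M\<ge>N. \<forall>x. norm x < 1 \<longrightarrow> norm (f x - f (trunc M x)) < \<epsilon>"
proof -
  obtain d where d: "0 < d" "\<And>x y. norm x < 1 \<Longrightarrow> norm y < 1 \<Longrightarrow> dist x y < d \<Longrightarrow> dist (f x) (f y) < \<epsilon> / 3"
    using Au_uniformly_continuous[OF f, of "\<epsilon> / 3"] \<open>0 < \<epsilon>\<close> by auto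
  define r where "r = max (1/2) (1 - d / 2)"
  have r: "0 < r" "r < 1" "1 - r < d" using d(1) by (auto simp: r_def)
  have C: "0 \<le> supnorm f" using norm_le_supnorm[OF Au_imp_Hinf[OF f], of 0] by (simp add: order_trans[OF norm_ge_zero])
  obtain \<eta> where \<eta>: "0 < \<eta>" "\<And>h. h holomorphic_on ball 0 1 \<Longrightarrow> (\<And>z. norm z < 1 \<Longrightarrow> norm (h z) \<le> 2 * supnorm f) \<Longrightarrow>
    (\<And>z. norm z \<le> 1/8 \<Longrightarrow> norm (h z) \<le> \<eta>) \<Longrightarrow> norm (h (of_real r)) < \<epsilon> / 3"
    using holomorphic_small_on_small_disc[OF r(1,2), of "2 * supnorm f" "\<epsilon> / 3"] C \<open>0 < \<epsilon>\<close> by auto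
  obtain N where N: "\<And>M x. N \<le> M \<Longrightarrow> norm x \<le> 1/8 \<Longrightarrow> norm (f x - f (trunc M x)) < \<eta>"
    using trunc_uniform_small_ball[OF f \<eta>(1)] by blast
  have "norm (f x - f (trunc M x)) < \<epsilon>" if M: "N \<le> M" and x: "norm x < 1" for M x
  proof -
    have sc: "norm (c0_scaleC z y) < 1" "norm (c0_scaleC z y) \<le> norm z" if "norm y < 1" "norm z \<le> 1" for z y
    proof -
      have "norm z * norm y \<le> 1 * norm y" "norm z * norm y \<le> norm z * 1"
        using that by (intro mult_mono; simp)+
      then show "norm (c0_scaleC z y) < 1" "norm (c0_scaleC z y) \<le> norm z"
        using norm_c0_scaleC_le[of z y] that by auto
    qed
    have t: "norm (trunc M x) < 1" using norm_trunc_le[of M x] x by simp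
    have ts: "c0_scaleC z (trunc M x) = trunc M (c0_scaleC z x)" for z by (rule c0_eqI) auto
    define h where "h z = f (c0_scaleC z x) - f (c0_scaleC z (trunc M x))" for z
    have "norm (h (of_real r)) < \<epsilon> / 3"
    proof (rule \<eta>(2))
      show "h holomorphic_on ball 0 1"
        unfolding h_def using Hinf_line[OF Au_imp_Hinf[OF f], of "ball 0 1" 0] sc(1) x t
        by (intro holomorphic_on_diff) (auto simp del: cc_initial_segment)
      fix z :: complex
      show "norm (h z) \<le> 2 * supnorm f" if "norm z < 1"
        using norm_triangle_ineq4[of "f (c0_scaleC z x)" "f (c0_scaleC z (trunc M x))"]
          norm_le_supnorm[OF Au_imp_Hinf[OF f] sc(1)[OF x, of z]]
          norm_le_supnorm[OF Au_imp_Hinf[OF f] sc(1)[OF t, of z]] that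
        unfolding h_def by linarith
      show "norm (h z) \<le> \<eta>" if "norm z \<le> 1/8"
        using N[OF M, of "c0_scaleC z x"] sc(2)[OF x, of z] that unfolding h_def ts by simp
    qed
    moreover have "dist (f y) (f (c0_scaleC (of_real r) y)) < \<epsilon> / 3" if "norm y < 1" for y
    proof (rule d(2)[OF that])
      show "norm (c0_scaleC (of_real r) y) < 1" using sc(1)[OF that, of "of_real r"] r by simp
      have "y - c0_scaleC (of_real r) y = c0_scaleC (of_real (1 - r)) y" by (rule c0_eqI) (simp add: algebra_simps)
      then show "dist y (c0_scaleC (of_real r) y) < d"
        using sc(2)[OF that, of "of_real (1 - r)"] r by (simp add: dist_norm del: of_real_diff)
    qed
    from this[OF x] this[OF t]
    have "norm (f x - f (c0_scaleC (of_real r) x)) < \<epsilon> / 3"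
      "norm (f (c0_scaleC (of_real r) (trunc M x)) - f (trunc M x)) < \<epsilon> / 3"
      by (simp_all add: dist_norm norm_minus_commute)
    moreover have *: "f x - f (trunc M x) = (f x - f (c0_scaleC (of_real r) x)) + h (of_real r) +
        (f (c0_scaleC (of_real r) (trunc M x)) - f (trunc M x))"
      by (simp add: h_def)
    have tri: "norm (a + b + c) \<le> norm a + norm b + norm c" for a b c :: complex
      using norm_triangle_ineq[of "a + b" c] norm_triangle_ineq[of a b] by linarith
    have "norm (f x - f (trunc M x)) \<le> norm (f x - f (c0_scaleC (of_real r) x)) + norm (h (of_real r)) +
        norm (f (c0_scaleC (of_real r) (trunc M x)) - f (trunc M x))"
      unfolding * by (rule tri)
    ultimately show ?thesis by linarith
  qed
  then show ?thesis by blast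
qed


section \<open>The canonical extension\<close>

text \<open>The factor below 1 keeps the truncations of a point of the closed ball inside the open ball.\<close>

definition approx :: "nat \<Rightarrow> linf \<Rightarrow> c0"
  where "approx N z = initial_segment N (\<lambda>n. of_real ((real N + 1) / (real N + 2)) * apply_bcontfun z n)"

lemma shrink_factor:
  "0 < (real N + 1) / (real N + 2)" "(real N + 1) / (real N + 2) < 1"
  "(\<lambda>N. (real N + 1) / (real N + 2)) \<longlonglongrightarrow> 1"
proof -
  show "(\<lambda>N. (real N + 1) / (real N + 2)) \<longlonglongrightarrow> 1"
    using LIMSEQ_Suc[OF LIMSEQ_n_over_Suc_n[where 'a = real]] by (simp add: algebra_simps)
qed auto

lemma cc_approx: "cc (approx N z) n = (if n < N then of_real ((real N + 1) / (real N + 2)) * apply_bcontfun z n else 0)"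
  by (simp add: approx_def)

lemma norm_linf_coord_le: "norm (apply_bcontfun z n) \<le> 1" if "norm z \<le> 1" for z :: linf
  using norm_bounded[of z n] that by linarith

lemma norm_initial_segment_scaled_le: "norm (initial_segment N (\<lambda>n. of_real s * apply_bcontfun z n)) \<le> \<bar>s\<bar>" if "norm z \<le> 1" for z :: linf
  using norm_linf_coord_le[OF that] by (intro norm_initial_segment_le) (auto simp: norm_mult mult_left_le)

lemma norm_approx_less: "norm (approx N z) < 1" if "norm z \<le> 1"
  unfolding approx_def using norm_initial_segment_scaled_le[OF that, of N "(real N + 1) / (real N + 2)"] shrink_factor(1,2)[of N]
  by linarith

lemma summable_pairing: "summable (\<lambda>n. a n * apply_bcontfun x n)" if "a \<in> ell1"
proof (rule summable_norm_cancel, rule summable_comparison_test)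
  show "summable (\<lambda>n. norm (a n) * norm x)" using that by (simp add: ell1_def summable_mult2)
  show "\<exists>N. \<forall>n\<ge>N. norm (norm (a n * apply_bcontfun x n)) \<le> norm (a n) * norm x"
    by (simp add: norm_mult mult_left_mono norm_bounded)
qed

lemma pairing_approx_tendsto: "(\<lambda>N. pairing a (c0_linf (approx N z))) \<longlonglongrightarrow> pairing a z" if "a \<in> ell1"
proof -
  have eq: "pairing a (c0_linf (approx N z)) = of_real ((real N + 1) / (real N + 2)) * (\<Sum>n<N. a n * apply_bcontfun z n)" for N
  proof -
    have "pairing a (c0_linf (approx N z)) = (\<Sum>n<N. a n * cc (approx N z) n)"
      unfolding pairing_def by (intro suminf_finite) (auto simp: cc_approx)
    also have "\<dots> = (\<Sum>n<N. of_real ((real N + 1) / (real N + 2)) * (a n * apply_bcontfun z n))"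
      by (intro sum.cong) (auto simp: cc_approx)
    finally show ?thesis by (simp add: sum_distrib_left)
  qed
  have "(\<lambda>N. of_real ((real N + 1) / (real N + 2)) * (\<Sum>n<N. a n * apply_bcontfun z n)) \<longlonglongrightarrow> of_real 1 * pairing a z"
    unfolding pairing_def
    by (intro tendsto_mult tendsto_of_real shrink_factor(3) summable_LIMSEQ summable_pairing that)
  then show ?thesis by (simp add: eq)
qed

abbreviation unit_seq :: "nat \<Rightarrow> nat \<Rightarrow> complex"
  where "unit_seq n \<equiv> \<lambda>k. of_bool (k = n)"

lemma unit_seq_ell1: "unit_seq n \<in> ell1"
  unfolding ell1_def by (auto intro: summable_finite[of "{n}"])

lemma pairing_unit_seq: "pairing (unit_seq n) z = apply_bcontfun z n"
  unfolding pairing_def by (subst suminf_finite[of "{n}"]) auto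

section \<open>Weak-star limits and continuity\<close>

lemma topspace_weak_star [simp]: "topspace weak_star = UNIV"
proof -
  have "(\<lambda>_. 0) \<in> ell1" by (simp add: ell1_def)
  then have "UNIV \<in> {{x. pairing a x \<in> U} | a U. a \<in> ell1 \<and> open U}"
    by (auto intro!: exI[of _ "\<lambda>_. 0"] exI[of _ UNIV])
  then show ?thesis unfolding weak_star_def topology_generated_by_topspace by blast
qed

text \<open>Convergence needs testing on subbasic sets only, by induction on the generation of the
  open set.\<close>

lemma limitin_weak_star:
  assumes "\<And>a. a \<in> ell1 \<Longrightarrow> ((\<lambda>i. pairing a (X i)) \<longlongrightarrow> pairing a z) F"
  shows "limitin weak_star X z F"
  unfolding limitin_def
proof (intro conjI allI impI)
  fix U assume U: "openin weak_star U \<and> z \<in> U"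
  then have "generate_topology_on {{x. pairing a x \<in> U} | a U. a \<in> ell1 \<and> open U} U"
    unfolding weak_star_def openin_topology_generated_by_iff by simp
  then have "z \<in> U \<longrightarrow> (\<forall>\<^sub>F i in F. X i \<in> U)"
  proof induction
    case (Int a b)
    then show ?case using eventually_conj by auto
  next
    case (UN K)
    show ?case
    proof
      assume "z \<in> \<Union>K"
      then obtain k where k: "k \<in> K" "z \<in> k" by blast
      then have "\<forall>\<^sub>F i in F. X i \<in> k" using UN by blast
      then show "\<forall>\<^sub>F i in F. X i \<in> \<Union>K" by (rule eventually_mono) (use k in blast)
    qed
  next
    case (Basis s)
    then obtain a U where "s = {x. pairing a x \<in> U}" "a \<in> ell1" "open U" by blast
    then show ?case using topological_tendstoD[OF assms] by auto
  qed simp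
  then show "\<forall>\<^sub>F i in F. X i \<in> U" using U by blast
qed simp

text \<open>A coordinate is the pairing with a unit sequence, hence weak-star continuous; for
  \<open>z\<close> outside the subspace the filter is trivial.\<close>

lemma tendsto_coord_atin:
  "((\<lambda>x. apply_bcontfun x n) \<longlongrightarrow> apply_bcontfun z n) (atin (subtopology weak_star S) z)"
proof -
  have "openin weak_star {x. pairing (unit_seq n) x \<in> U}" if "open U" for U
    unfolding weak_star_def by (rule topology_generated_by_Basis) (use unit_seq_ell1 that in blast)
  then have "continuous_map weak_star euclidean (pairing (unit_seq n))"
    by (simp add: continuous_map_def)
  then have "continuous_map (subtopology weak_star S) euclidean (\<lambda>x. apply_bcontfun x n)"
    using continuous_map_from_subtopology unfolding pairing_unit_seq by blast
  then have "limitin euclidean (\<lambda>x. apply_bcontfun x n) (apply_bcontfun z n) (atin (subtopology weak_star S) z)"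
    if "z \<in> topspace (subtopology weak_star S)"
    using that by (auto simp: continuous_map_atin)
  moreover have "atin (subtopology weak_star S) z = bot" if "z \<notin> topspace (subtopology weak_star S)"
    using that by (rule atin_degenerate)
  ultimately show ?thesis by (cases "z \<in> topspace (subtopology weak_star S)") auto
qed

lemma tendsto_initial_segment:
  assumes "\<And>n. n < N \<Longrightarrow> ((\<lambda>x. g x n) \<longlongrightarrow> l n) F"
  shows "((\<lambda>x. initial_segment N (g x)) \<longlongrightarrow> initial_segment N l) F"
  using assms
proof (induction N)
  case (Suc N)
  show ?case
    unfolding initial_segment_Suc[of N "g _"] initial_segment_Suc[of N l]
    using Suc by (intro tendsto_add bounded_linear.tendsto[OF bounded_linear_c0_scaleC]) auto
qed simp

text \<open>The point \<open>approx N z\<close> depends on finitely many coordinates of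
  \<open>z\<close>, so \<open>approx N\<close> is continuous from the weak-star topology to the norm
  of \<open>c0\<close>.\<close>

lemma continuous_map_approx:
  assumes "f \<in> Hinf"
  shows "continuous_map (subtopology weak_star (cball 0 1)) euclidean (\<lambda>z. f (approx N z))"
  unfolding continuous_map_atin
proof safe
  fix z assume "z \<in> topspace (subtopology weak_star (cball 0 1))"
  then have "norm z \<le> 1" by simp
  then have "((\<lambda>z. f (approx N z)) \<longlongrightarrow> f (approx N z)) (atin (subtopology weak_star (cball 0 1)) z)"
    unfolding approx_def using norm_approx_less[of z N] unfolding approx_def
    by (intro isCont_tendsto_compose[OF Hinf_isCont[OF assms]] tendsto_initial_segment tendsto_mult tendsto_const tendsto_coord_atin)
  then show "limitin euclidean (\<lambda>z. f (approx N z)) (f (approx N z)) (atin (subtopology weak_star (cball 0 1)) z)"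
    by simp
qed

text \<open>For \<open>N \<le> M\<close>, first truncate \<open>approx M z\<close> at
  \<open>N\<close>, at a cost bounded by \<open>trunc_uniform\<close>, and then exchange the scaling
  factors, at a cost bounded by uniform continuity. Both bounds are uniform in
  \<open>z\<close>.\<close>

lemma approx_uniformly_Cauchy:
  assumes f: "f \<in> Au" and "0 < e"
  shows "\<exists>K. \<forall>M\<ge>K. \<forall>N\<ge>K. \<forall>z. norm z \<le> 1 \<longrightarrow> dist (f (approx M z)) (f (approx N z)) < e"
proof -
  obtain d where d: "0 < d" "\<And>x y. norm x < 1 \<Longrightarrow> norm y < 1 \<Longrightarrow> dist x y < d \<Longrightarrow> dist (f x) (f y) < e / 2"
    using Au_uniformly_continuous[OF f, of "e / 2"] \<open>0 < e\<close> by auto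
  obtain N0 where N0: "\<And>M x. N0 \<le> M \<Longrightarrow> norm x < 1 \<Longrightarrow> norm (f x - f (trunc M x)) < e / 2"
    using trunc_uniform[OF f, of "e / 2"] \<open>0 < e\<close> by auto
  let ?s = "\<lambda>N. (real N + 1) / (real N + 2)"
  obtain N1 where N1: "\<And>M N. N1 \<le> M \<Longrightarrow> N1 \<le> N \<Longrightarrow> dist (?s M) (?s N) < d"
    using LIMSEQ_imp_Cauchy[OF shrink_factor(3)] d(1) unfolding Cauchy_def by blast
  have *: "dist (f (approx M z)) (f (approx N z)) < e"
    if "max N0 N1 \<le> N" "N \<le> M" "norm z \<le> 1" for M N z
  proof -
    let ?y = "initial_segment N (\<lambda>n. of_real (?s M) * apply_bcontfun z n)"
    have y: "trunc N (approx M z) = ?y" using that(2) by (intro c0_eqI) (simp add: cc_approx)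
    have "dist (f (approx M z)) (f ?y) < e / 2"
      using N0[of N "approx M z"] that norm_approx_less[OF that(3)] unfolding y dist_norm by simp
    moreover have "dist (f ?y) (f (approx N z)) < e / 2"
    proof (rule d(2))
      show "norm ?y < 1"
        using norm_trunc_le[of N "approx M z"] norm_approx_less[OF that(3), of M] unfolding y by linarith
      show "norm (approx N z) < 1" by (rule norm_approx_less[OF that(3)])
      have "?y - approx N z = initial_segment N (\<lambda>n. of_real (?s M - ?s N) * apply_bcontfun z n)"
        by (rule c0_eqI) (simp add: cc_approx algebra_simps del: of_real_divide)
      then have "dist ?y (approx N z) \<le> \<bar>?s M - ?s N\<bar>"
        using norm_initial_segment_scaled_le[OF that(3), of N "?s M - ?s N"] by (simp add: dist_norm)
      also have "\<dots> < d" using N1[of M N] that by (simp add: dist_real_def)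
      finally show "dist ?y (approx N z) < d" .
    qed
    ultimately show ?thesis using dist_triangle[of "f (approx M z)" "f (approx N z)" "f ?y"] by linarith
  qed
  have "dist (f (approx M z)) (f (approx N z)) < e"
    if "max N0 N1 \<le> N" "max N0 N1 \<le> M" "norm z \<le> 1" for M N z
    using *[of N M z] *[of M N z] that by (cases "N \<le> M") (simp_all add: dist_commute)
  then show ?thesis by blast
qed

lemma approx_tendsto_c0: "(\<lambda>N. approx N (c0_linf x)) \<longlonglongrightarrow> x"
proof -
  have "approx N (c0_linf x) = c0_scaleC (of_real ((real N + 1) / (real N + 2))) (trunc N x)" for N
    by (rule c0_eqI) (simp add: cc_approx)
  moreover have "c0_scaleC (of_real r) y = r *\<^sub>R y" for r y
    by (rule c0_eqI) (simp add: scaleR_conv_of_real)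
  moreover have "(\<lambda>N. ((real N + 1) / (real N + 2)) *\<^sub>R trunc N x) \<longlonglongrightarrow> 1 *\<^sub>R x"
    by (intro tendsto_scaleR shrink_factor(3) trunc_tendsto)
  ultimately show ?thesis by (simp del: of_real_divide)
qed

text \<open>The limit is a uniform limit of weak-star continuous functions and agrees with
  \<open>f\<close> on the open ball, where \<open>approx N\<close> converges in norm. Any other such
  extension coincides with it, because the points \<open>approx N z\<close> of the open ball
  converge weak-star to \<open>z\<close>.\<close>

theorem canonical_ext_tendsto:
  assumes f: "f \<in> Au" and z: "norm z \<le> 1"
  shows "(\<lambda>N. f (approx N z)) \<longlonglongrightarrow> canonical_ext f z"
proof -
  let ?X = "subtopology weak_star (cball 0 1)"
  define g where "g = (\<lambda>z\<in>cball 0 1. lim (\<lambda>N. f (approx N z)))"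
  have lim: "(\<lambda>N. f (approx N z)) \<longlonglongrightarrow> g z" if "norm z \<le> 1" for z
  proof -
    have "Cauchy (\<lambda>N. f (approx N z))"
      using approx_uniformly_Cauchy[OF f] that unfolding Cauchy_def by meson
    then show ?thesis
      using that by (simp add: g_def Cauchy_convergent_iff convergent_LIMSEQ_iff)
  qed
  have unif: "\<forall>\<^sub>F N in sequentially. \<forall>x\<in>topspace ?X. g x \<in> UNIV \<and> dist (f (approx N x)) (g x) < e" if "0 < e" for e
  proof -
    obtain K where K: "\<And>M N z. K \<le> M \<Longrightarrow> K \<le> N \<Longrightarrow> norm z \<le> 1 \<Longrightarrow> dist (f (approx M z)) (f (approx N z)) < e / 2"
      using approx_uniformly_Cauchy[OF f, of "e / 2"] \<open>0 < e\<close> by auto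
    have "dist (f (approx N x)) (g x) < e" if "K \<le> N" "norm x \<le> 1" for N x
    proof -
      have "(\<lambda>M. dist (f (approx N x)) (f (approx M x))) \<longlonglongrightarrow> dist (f (approx N x)) (g x)"
        by (intro tendsto_intros lim that)
      then have "dist (f (approx N x)) (g x) \<le> e / 2"
        by (rule LIMSEQ_le_const2) (use K that in \<open>auto intro!: exI[of _ K] less_imp_le\<close>)
      then show ?thesis using \<open>0 < e\<close> by simp
    qed
    then show ?thesis by (auto simp: eventually_sequentially intro!: exI[of _ K])
  qed
  have "continuous_map ?X Met_TC.mtopology g"
  proof (rule Met_TC.continuous_map_uniform_limit[where F = sequentially and f = "\<lambda>N z. f (approx N z)"])
    show "\<forall>\<^sub>F N in sequentially. continuous_map ?X Met_TC.mtopology (\<lambda>z. f (approx N z))"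
      using continuous_map_approx[OF Au_imp_Hinf[OF f]] by simp
  qed (use unif in auto)
  then have cont: "continuous_map ?X euclidean g" by simp
  have agree: "g (c0_linf x) = f x" if "x \<in> ball 0 1" for x
  proof -
    have "norm x < 1" using that by simp
    then have "(\<lambda>N. f (approx N (c0_linf x))) \<longlonglongrightarrow> f x"
      by (intro isCont_tendsto_compose[OF Hinf_isCont[OF Au_imp_Hinf[OF f]]] approx_tendsto_c0)
    moreover have "norm (c0_linf x) \<le> 1" using \<open>norm x < 1\<close> by (simp add: norm_c0.rep_eq)
    ultimately show ?thesis using lim LIMSEQ_unique by blast
  qed
  have "canonical_ext f = g"
    unfolding canonical_ext_def
  proof (rule the_equality)
    show "g \<in> extensional (cball 0 1) \<and> continuous_map ?X euclidean g \<and> (\<forall>x\<in>ball 0 1. g (c0_linf x) = f x)"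
      using cont agree by (simp add: g_def)
    fix h assume h: "h \<in> extensional (cball 0 1) \<and> continuous_map ?X euclidean h \<and> (\<forall>x\<in>ball 0 1. h (c0_linf x) = f x)"
    show "h = g"
    proof (rule extensionalityI[of _ "cball 0 1"])
      show "h \<in> extensional (cball 0 1)" "g \<in> extensional (cball 0 1)" using h by (auto simp: g_def)
      fix z :: linf assume "z \<in> cball 0 1"
      then have z: "norm z \<le> 1" by simp
      have "norm (c0_linf (approx N z)) \<le> 1" for N
        using norm_approx_less[OF z, of N] by (simp add: norm_c0.rep_eq)
      then have "limitin ?X (\<lambda>N. c0_linf (approx N z)) z sequentially"
        unfolding limitin_subtopology using z by (auto intro!: limitin_weak_star pairing_approx_tendsto)
      then have "limitin euclidean (h \<circ> (\<lambda>N. c0_linf (approx N z))) (h z) sequentially"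
        using h by (intro continuous_map_limit[where X = ?X]) auto
      moreover have "h (c0_linf (approx N z)) = f (approx N z)" for N
        using h norm_approx_less[OF z, of N] by simp
      ultimately have "(\<lambda>N. f (approx N z)) \<longlonglongrightarrow> h z" by (simp add: o_def)
      then show "h z = g z" using lim[OF z] LIMSEQ_unique by blast
    qed
  qed
  then show ?thesis using lim[OF z] by simp
qed


section \<open>Closure properties of \<open>Hinf\<close> and \<open>Au\<close>, and evaluation
  characters\<close>

definition cdiff :: "(c0 \<Rightarrow> complex) \<Rightarrow> c0 \<Rightarrow> bool"
  where "cdiff F x \<longleftrightarrow> (\<exists>D. (F has_derivative D) (at x) \<and> (\<forall>c h. D (c0_scaleC c h) = c * D h))"

lemma cdiffI: "(F has_derivative D) (at x) \<Longrightarrow> (\<And>c h. D (c0_scaleC c h) = c * D h) \<Longrightarrow> cdiff F x"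
  unfolding cdiff_def by blast

lemma cdiff_const: "cdiff (\<lambda>_. c) x"
  by (rule cdiffI[of _ "\<lambda>_. 0"]) auto

lemma cdiff_add:
  assumes "cdiff F x" "cdiff G x"
  shows "cdiff (\<lambda>x. F x + G x) x"
proof -
  obtain D E where D: "(F has_derivative D) (at x)" "\<And>c h. D (c0_scaleC c h) = c * D h"
    and E: "(G has_derivative E) (at x)" "\<And>c h. E (c0_scaleC c h) = c * E h"
    using assms unfolding cdiff_def by blast
  show ?thesis by (rule cdiffI[OF has_derivative_add[OF D(1) E(1)]]) (simp add: D(2) E(2) algebra_simps)
qed

lemma cdiff_mult:
  assumes "cdiff F x" "cdiff G x"
  shows "cdiff (\<lambda>x. F x * G x) x"
proof -
  obtain D E where D: "(F has_derivative D) (at x)" "\<And>c h. D (c0_scaleC c h) = c * D h"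
    and E: "(G has_derivative E) (at x)" "\<And>c h. E (c0_scaleC c h) = c * E h"
    using assms unfolding cdiff_def by blast
  show ?thesis by (rule cdiffI[OF has_derivative_mult[OF D(1) E(1)]]) (simp add: D(2) E(2) algebra_simps)
qed

lemma cdiff_compose:
  assumes "cdiff F x" "\<phi> field_differentiable at (F x)"
  shows "cdiff (\<lambda>x. \<phi> (F x)) x"
proof -
  obtain D where D: "(F has_derivative D) (at x)" "\<And>c h. D (c0_scaleC c h) = c * D h"
    using assms(1) unfolding cdiff_def by blast
  obtain d where "(\<phi> has_derivative (*) d) (at (F x))"
    using assms(2) unfolding field_differentiable_def has_field_derivative_def by blast
  from diff_chain_at[OF D(1) this] show ?thesis
    by (intro cdiffI[of _ "\<lambda>h. d * D h"]) (auto simp: o_def D(2))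
qed

lemma Hinf_cdiff: "f \<in> Hinf \<Longrightarrow> norm x < 1 \<Longrightarrow> cdiff f x"
  unfolding Hinf_def cdiff_def by auto

text \<open>Restricting \<open>F\<close> to the ball makes it extensional and leaves derivatives
  unchanged at points of the ball, which is open.\<close>

lemma HinfI:
  assumes "\<And>x. norm x < 1 \<Longrightarrow> cdiff F x" "\<And>x. norm x < 1 \<Longrightarrow> norm (F x) \<le> B"
  shows "(\<lambda>x\<in>ball 0 1. F x) \<in> Hinf"
proof -
  have "\<exists>D. ((\<lambda>x\<in>ball 0 1. F x) has_derivative D) (at x) \<and> (\<forall>c h. D (c0_scaleC c h) = c * D h)"
    if x: "x \<in> ball 0 1" for x
  proof -
    obtain D where D: "(F has_derivative D) (at x)" "\<forall>c h. D (c0_scaleC c h) = c * D h"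
      using assms(1)[of x] x unfolding cdiff_def by auto
    have "((\<lambda>x\<in>ball 0 1. F x) has_derivative D) (at x)"
      by (rule has_derivative_transform_within_open[OF D(1) open_ball x]) simp
    with D(2) show ?thesis by blast
  qed
  moreover have "bounded ((\<lambda>x\<in>ball 0 1. F x) ` ball 0 1)"
    using assms(2) unfolding bounded_iff by (intro exI[of _ B]) auto
  ultimately show ?thesis unfolding Hinf_def by auto
qed

lemma Hinf_const: "(\<lambda>x\<in>ball 0 1. c) \<in> Hinf"
  by (rule HinfI[of _ "norm c"]) (auto simp: cdiff_const)

lemma Hinf_add: "(\<lambda>x\<in>ball 0 1. f x + g x) \<in> Hinf" if "f \<in> Hinf" "g \<in> Hinf"
proof (rule HinfI[of _ "supnorm f + supnorm g"])
  show "norm (f x + g x) \<le> supnorm f + supnorm g" if "norm x < 1" for x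
    using \<open>f \<in> Hinf\<close> \<open>g \<in> Hinf\<close> that by (intro norm_triangle_mono norm_le_supnorm)
qed (simp add: cdiff_add Hinf_cdiff that)

lemma Hinf_mult: "(\<lambda>x\<in>ball 0 1. f x * g x) \<in> Hinf" if "f \<in> Hinf" "g \<in> Hinf"
proof (rule HinfI[of _ "supnorm f * supnorm g"])
  show "norm (f x * g x) \<le> supnorm f * supnorm g" if "norm x < 1" for x
    unfolding norm_mult using norm_le_supnorm[OF \<open>f \<in> Hinf\<close> that] norm_le_supnorm[OF \<open>g \<in> Hinf\<close> that]
    by (meson mult_mono norm_ge_zero order_trans)
qed (simp add: cdiff_mult Hinf_cdiff that)

lemma Hinf_cmult: "(\<lambda>x\<in>ball 0 1. c * f x) \<in> Hinf" if "f \<in> Hinf"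
proof (rule HinfI[of _ "norm c * supnorm f"])
  show "norm (c * f x) \<le> norm c * supnorm f" if "norm x < 1" for x
    unfolding norm_mult using norm_le_supnorm[OF \<open>f \<in> Hinf\<close> that] by (intro mult_left_mono) auto
qed (simp add: cdiff_mult cdiff_const Hinf_cdiff that)

lemma Hinf_compose:
  assumes "f \<in> Hinf" "\<And>x. norm x < 1 \<Longrightarrow> \<phi> field_differentiable at (f x)"
    "\<And>x. norm x < 1 \<Longrightarrow> norm (\<phi> (f x)) \<le> B"
  shows "(\<lambda>x\<in>ball 0 1. \<phi> (f x)) \<in> Hinf"
proof (rule HinfI[of _ B])
  show "cdiff (\<lambda>x. \<phi> (f x)) x" if "norm x < 1" for x
    by (rule cdiff_compose[of f x \<phi>, OF Hinf_cdiff[OF assms(1) that] assms(2)[OF that]])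
qed (rule assms(3))

lemma pairing_bounded_linear:
  assumes "a \<in> ell1"
  shows "bounded_linear (\<lambda>x. pairing a (c0_linf x))"
    and "pairing a (c0_linf (c0_scaleC c x)) = c * pairing a (c0_linf x)"
proof -
  have s: "summable (\<lambda>n. a n * cc x n)" for x by (rule summable_pairing[OF assms])
  show "pairing a (c0_linf (c0_scaleC c x)) = c * pairing a (c0_linf x)"
    unfolding pairing_def by (simp add: suminf_mult[OF s, symmetric] mult_ac)
  show "bounded_linear (\<lambda>x. pairing a (c0_linf x))"
  proof (rule bounded_linear_intro[where K = "\<Sum>n. norm (a n)"])
    show "pairing a (c0_linf (x + y)) = pairing a (c0_linf x) + pairing a (c0_linf y)" for x y
      unfolding pairing_def by (simp add: suminf_add[OF s s] ring_distribs)
    show "pairing a (c0_linf (r *\<^sub>R x)) = r *\<^sub>R pairing a (c0_linf x)" for r x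
      unfolding pairing_def by (simp add: suminf_scaleR_right[OF s, symmetric])
    fix x
    have sa: "summable (\<lambda>n. norm (a n))" using assms by (simp add: ell1_def)
    have "norm (pairing a (c0_linf x)) \<le> (\<Sum>n. norm (a n) * norm x)"
      unfolding pairing_def using sa
      by (intro norm_suminf_le) (auto simp: norm_mult norm_cc_le mult_left_mono summable_mult2)
    then show "norm (pairing a (c0_linf x)) \<le> norm x * (\<Sum>n. norm (a n))"
      using suminf_mult2[OF sa, of "norm x"] by (simp add: mult.commute)
  qed
qed

lemma cdiff_pairing: "cdiff (\<lambda>x. pairing a (c0_linf x)) x" if "a \<in> ell1"
  by (rule cdiffI[OF bounded_linear_imp_has_derivative[OF pairing_bounded_linear(1)[OF that]]])
    (rule pairing_bounded_linear(2)[OF that])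

lemma ell1_fun_Hinf:
  assumes "a \<in> ell1"
  shows "ell1_fun a \<in> Hinf"
proof -
  obtain K where K: "\<And>x. norm (pairing a (c0_linf x)) \<le> norm x * K" "0 < K"
    using bounded_linear.pos_bounded[OF pairing_bounded_linear(1)[OF assms]] by auto
  have "norm (pairing a (c0_linf x)) \<le> K" if "norm x < 1" for x
    using K(1)[of x] mult_right_mono[of "norm x" 1 K] that K(2) by linarith
  then show ?thesis
    unfolding ell1_fun_def by (intro HinfI[of _ K] cdiff_pairing assms) auto
qed

lemma AuI:
  assumes "(\<lambda>x\<in>ball 0 1. F x) \<in> Hinf" "uniformly_continuous_on (ball 0 1) F"
  shows "(\<lambda>x\<in>ball 0 1. F x) \<in> Au"
proof -
  have "uniformly_continuous_on (ball 0 1) (\<lambda>x\<in>ball 0 1. F x)"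
    unfolding uniformly_continuous_on_def
  proof (intro allI impI)
    fix e :: real assume "0 < e"
    then obtain d where "0 < d" "\<forall>x\<in>ball 0 1. \<forall>x'\<in>ball 0 1. dist x' x < d \<longrightarrow> dist (F x') (F x) < e"
      using assms(2) unfolding uniformly_continuous_on_def by blast
    then show "\<exists>d>0. \<forall>x\<in>ball 0 1. \<forall>x'\<in>ball 0 1. dist x' x < d \<longrightarrow>
        dist ((\<lambda>x\<in>ball 0 1. F x) x') ((\<lambda>x\<in>ball 0 1. F x) x) < e"
      by (intro exI[of _ d]) simp
  qed
  with assms(1) show ?thesis unfolding Au_def by blast
qed

lemma Au_const: "(\<lambda>x\<in>ball 0 1. c) \<in> Au"
  by (intro AuI Hinf_const uniformly_continuous_on_const)

lemma Au_add: "(\<lambda>x\<in>ball 0 1. f x + g x) \<in> Au" if "f \<in> Au" "g \<in> Au"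
  using that by (intro AuI Hinf_add uniformly_continuous_on_add) (auto simp: Au_def)

lemma Au_cmult: "(\<lambda>x\<in>ball 0 1. c * f x) \<in> Au" if "f \<in> Au"
proof (rule AuI[OF Hinf_cmult])
  show "f \<in> Hinf" using that by (simp add: Au_def)
  have "uniformly_continuous_on (ball 0 1) f" using that by (simp add: Au_def)
  then show "uniformly_continuous_on (ball 0 1) (\<lambda>x. c * f x)"
    by (rule bounded_linear.uniformly_continuous_on[OF bounded_linear_mult_right])
qed

lemma Au_mult:
  assumes "f \<in> Au" "g \<in> Au"
  shows "(\<lambda>x\<in>ball 0 1. f x * g x) \<in> Au"
proof (intro AuI Hinf_mult)
  show h: "f \<in> Hinf" "g \<in> Hinf" using assms by (auto simp: Au_def)
  \<comment> \<open>A common bound for both factors; the summand 1 makes it positive even if both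
    supremum norms vanish.\<close>
  define C where "C = supnorm f + supnorm g + 1"
  have nn: "0 \<le> supnorm f" "0 \<le> supnorm g"
    using order_trans[OF norm_ge_zero norm_le_supnorm[OF h(1), of 0]]
      order_trans[OF norm_ge_zero norm_le_supnorm[OF h(2), of 0]] by auto
  have C: "0 < C" using nn by (simp add: C_def)
  have Cf: "norm (f x) \<le> C" and Cg: "norm (g x) \<le> C" if "norm x < 1" for x
    using norm_le_supnorm[OF h(1) that] norm_le_supnorm[OF h(2) that] nn unfolding C_def by linarith+
  show "uniformly_continuous_on (ball 0 1) (\<lambda>x. f x * g x)"
    unfolding uniformly_continuous_on_def
  proof (intro allI impI)
    fix e :: real assume "0 < e"
    then have e: "0 < e / (2 * C)" using C by simp
    obtain d1 where d1: "0 < d1" "\<And>x y. norm x < 1 \<Longrightarrow> norm y < 1 \<Longrightarrow> dist x y < d1 \<Longrightarrow> dist (f x) (f y) < e / (2 * C)"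
      using Au_uniformly_continuous[OF assms(1) e] by metis
    obtain d2 where d2: "0 < d2" "\<And>x y. norm x < 1 \<Longrightarrow> norm y < 1 \<Longrightarrow> dist x y < d2 \<Longrightarrow> dist (g x) (g y) < e / (2 * C)"
      using Au_uniformly_continuous[OF assms(2) e] by metis
    have "dist (f y * g y) (f x * g x) < e" if "norm x < 1" "norm y < 1" "dist y x < min d1 d2" for x y
    proof -
      have "norm (f y * g y - f x * g x) = norm (f y * (g y - g x) + (f y - f x) * g x)" by (simp add: algebra_simps)
      also have "\<dots> \<le> norm (f y) * norm (g y - g x) + norm (f y - f x) * norm (g x)"
        by (metis norm_triangle_ineq norm_mult)
      also have "\<dots> \<le> C * norm (g y - g x) + norm (f y - f x) * C"
        using Cf Cg that by (intro add_mono mult_right_mono mult_left_mono) auto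
      also have "\<dots> < C * (e / (2 * C)) + e / (2 * C) * C"
        using d1(2)[of y x] d2(2)[of y x] that C
        by (intro add_strict_mono mult_strict_left_mono mult_strict_right_mono) (auto simp: dist_norm)
      also have "\<dots> = e" using C by simp
      finally show ?thesis by (simp add: dist_norm)
    qed
    then show "\<exists>d>0. \<forall>x\<in>ball 0 1. \<forall>x'\<in>ball 0 1. dist x' x < d \<longrightarrow> dist (f x' * g x') (f x * g x) < e"
      using d1(1) d2(1) by (intro exI[of _ "min d1 d2"]) auto
  qed
qed

lemma delta_tendsto: "(\<lambda>N. f (approx N z)) \<longlonglongrightarrow> delta z f" if "f \<in> Au" "norm z \<le> 1"
  using canonical_ext_tendsto[OF that] that(1) by (simp add: delta_def)

lemma delta_in_char_space: "delta z \<in> char_space Au" if z: "norm z \<le> 1"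
proof -
  have ball: "approx N z \<in> ball 0 1" for N using norm_approx_less[OF z] by simp
  have "delta z (\<lambda>x\<in>ball 0 1. f x + g x) = delta z f + delta z g" if "f \<in> Au" "g \<in> Au" for f g
    using delta_tendsto[OF Au_add[OF that] z] tendsto_add[OF delta_tendsto[OF that(1) z] delta_tendsto[OF that(2) z]] ball
    by (auto intro: LIMSEQ_unique)
  moreover have "delta z (\<lambda>x\<in>ball 0 1. f x * g x) = delta z f * delta z g" if "f \<in> Au" "g \<in> Au" for f g
    using delta_tendsto[OF Au_mult[OF that] z] tendsto_mult[OF delta_tendsto[OF that(1) z] delta_tendsto[OF that(2) z]] ball
    by (auto intro: LIMSEQ_unique)
  moreover have "delta z (\<lambda>x\<in>ball 0 1. c * f x) = c * delta z f" if "f \<in> Au" for f c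
    using delta_tendsto[OF Au_cmult[OF that] z] tendsto_mult_left[OF delta_tendsto[OF that(1) z]] ball
    by (auto intro: LIMSEQ_unique)
  moreover have "delta z (\<lambda>x\<in>ball 0 1. 1) = 1"
    using delta_tendsto[OF Au_const z, of 1] ball by (simp add: LIMSEQ_const_iff)
  moreover have "delta z \<in> extensional Au" by (simp add: delta_def)
  ultimately show ?thesis
    unfolding char_space_def using Au_const[of 1] by (auto intro!: bexI[of _ "\<lambda>x\<in>ball 0 1. 1"])
qed

section \<open>Moebius transforms of the coordinates\<close>

lemma moebius_identity:
  "(norm (1 - cnj b * a))\<^sup>2 - (norm (a - b))\<^sup>2 = (1 - (norm a)\<^sup>2) * (1 - (norm b)\<^sup>2)" for a b :: complex
proof -
  have "(norm (1 - cnj b * a))\<^sup>2 - (norm (a - b))\<^sup>2 =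
    (1 - (Re b * Re a + Im b * Im a))\<^sup>2 + (Re b * Im a - Im b * Re a)\<^sup>2 - ((Re a - Re b)\<^sup>2 + (Im a - Im b)\<^sup>2)"
    unfolding cmod_power2 by (simp add: power2_commute)
  also have "\<dots> = (1 - ((Re a)\<^sup>2 + (Im a)\<^sup>2)) * (1 - ((Re b)\<^sup>2 + (Im b)\<^sup>2))"
    by algebra
  finally show ?thesis by (simp only: cmod_power2)
qed

lemma moebius_le: "norm (a - b) \<le> norm (1 - cnj b * a)" if "norm a \<le> 1" "norm b \<le> 1" for a b :: complex
proof -
  have "0 \<le> (1 - (norm a)\<^sup>2) * (1 - (norm b)\<^sup>2)"
    using that by (intro mult_nonneg_nonneg) (auto simp: power_le_one)
  then have "(norm (a - b))\<^sup>2 \<le> (norm (1 - cnj b * a))\<^sup>2" using moebius_identity[of b a] by linarith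
  then show ?thesis by (rule power2_le_imp_le) simp
qed

lemma moebius_denominator_ge: "1 - norm a \<le> norm (1 - cnj b * a)" if "norm b \<le> 1" for a b :: complex
proof -
  have "norm (cnj b * a) \<le> 1 * norm a" unfolding norm_mult using that by (intro mult_right_mono) auto
  then show ?thesis using norm_triangle_ineq2[of 1 "cnj b * a"] by simp
qed

text \<open>Contractivity of \<phi> bounds the set of values, so that \<open>Sup\<close> is an upper
  bound of it.\<close>

lemma norm_le_pseudo_hyp:
  assumes "\<And>f. f \<in> A \<Longrightarrow> supnorm f \<le> 1 \<Longrightarrow> norm (\<phi> f) \<le> 1"
    and "f \<in> A" "supnorm f \<le> 1" "\<psi> f = 0"
  shows "norm (\<phi> f) \<le> pseudo_hyp A \<phi> \<psi>"
  unfolding pseudo_hyp_def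
proof (rule cSup_upper)
  show "norm (\<phi> f) \<in> {norm (\<phi> f) |f. f \<in> A \<and> supnorm f \<le> 1 \<and> \<psi> f = 0}"
    using assms(2-4) by blast
  show "bdd_above {norm (\<phi> f) |f. f \<in> A \<and> supnorm f \<le> 1 \<and> \<psi> f = 0}"
    unfolding bdd_above_def using assms(1) by blast
qed

lemma norm_delta_le:
  assumes "f \<in> Au" "supnorm f \<le> 1" "norm z \<le> 1"
  shows "norm (delta z f) \<le> 1"
proof (rule LIMSEQ_le_const2[OF tendsto_norm[OF delta_tendsto[OF assms(1,3)]]])
  show "\<exists>N. \<forall>n\<ge>N. norm (f (approx n z)) \<le> 1"
    using norm_le_supnorm[OF Au_imp_Hinf[OF assms(1)] norm_approx_less[OF assms(3)]] assms(2) by (meson order_trans)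
qed

text \<open>The test function is a Moebius transform of \<open>t\<close> times the
  \<open>n\<close>-th coordinate that vanishes at \<open>w\<close>. Since \<open>t < 1\<close>, the
  transform has no pole on the closed disc even if the coordinate of \<open>w\<close> has modulus 1;
  it is uniformly continuous there, and the test function lies in \<open>Au\<close>.\<close>

lemma pseudo_hyp_coordinate:
  assumes z: "norm z \<le> 1" and w: "norm w \<le> 1" and "0 < t" "t < 1"
  shows "t * norm (apply_bcontfun z n - apply_bcontfun w n) \<le>
    pseudo_hyp Au (delta z) (delta w) * norm (1 - t\<^sup>2 * cnj (apply_bcontfun w n) * apply_bcontfun z n)"
proof -
  define b where "b = apply_bcontfun w n"
  have b: "norm (of_real t * b) < 1"
    using norm_linf_coord_le[OF w, of n] assms(3,4) mult_left_mono[of "norm b" 1 t]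
    unfolding b_def norm_mult norm_of_real by linarith
  define \<mu> where "\<mu> \<zeta> = (of_real t * \<zeta> - of_real t * b) / (1 - cnj (of_real t * b) * (of_real t * \<zeta>))" for \<zeta>
  have tz: "norm (of_real t * \<zeta>) < 1" if "norm \<zeta> \<le> 1" for \<zeta> :: complex
    using that assms(3,4) mult_left_mono[of "norm \<zeta>" 1 t] unfolding norm_mult norm_of_real by linarith
  have ne: "1 - cnj (of_real t * b) * (of_real t * \<zeta>) \<noteq> 0" if "norm \<zeta> \<le> 1" for \<zeta>
    using moebius_denominator_ge[of "of_real t * b" "of_real t * \<zeta>"] tz[OF that] b by auto
  have \<mu>1: "norm (\<mu> \<zeta>) \<le> 1" if "norm \<zeta> \<le> 1" for \<zeta>
    using moebius_le[of "of_real t * \<zeta>" "of_real t * b"] tz[OF that] b ne[OF that]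
    unfolding \<mu>_def norm_divide by (simp add: divide_le_eq_1)
  have fd: "\<mu> field_differentiable at \<zeta>" if "norm \<zeta> \<le> 1" for \<zeta>
    unfolding \<mu>_def using ne[OF that] by (intro derivative_intros) auto
  have cc: "cc x n \<in> cball 0 1" if "norm x < 1" for x using norm_cc_le[of x n] that by simp
  define F where "F = (\<lambda>x\<in>ball 0 1. \<mu> (cc x n))"
  have F: "F \<in> Au" unfolding F_def
  proof (rule AuI)
    show "(\<lambda>x\<in>ball 0 1. \<mu> (cc x n)) \<in> Hinf"
      using cdiff_pairing[OF unit_seq_ell1, of n] \<mu>1 fd cc unfolding pairing_unit_seq
      by (intro HinfI[of _ 1] cdiff_compose[of "\<lambda>x. cc x n" _ \<mu>]) auto
    have "uniformly_continuous_on (cball 0 1) \<mu>"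
      using fd by (intro compact_uniformly_continuous continuous_at_imp_continuous_on)
        (auto intro: field_differentiable_imp_continuous_at)
    moreover have "(\<lambda>x. cc x n) ` ball 0 1 \<subseteq> cball 0 1" using cc by auto
    ultimately have "uniformly_continuous_on ((\<lambda>x. cc x n) ` ball 0 1) \<mu>"
      unfolding uniformly_continuous_on_def by (meson subsetD)
    moreover have "uniformly_continuous_on (ball 0 1) (\<lambda>x. cc x n)"
      using bounded_linear.uniformly_continuous_on[OF pairing_bounded_linear(1)[OF unit_seq_ell1] uniformly_continuous_on_id]
      unfolding pairing_unit_seq .
    ultimately show "uniformly_continuous_on (ball 0 1) (\<lambda>x. \<mu> (cc x n))"
      using uniformly_continuous_on_compose[of "ball 0 1" "\<lambda>x. cc x n" \<mu>] by (simp add: o_def)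
  qed
  have dF: "delta u F = \<mu> (apply_bcontfun u n)" if u: "norm u \<le> 1" for u
  proof (rule LIMSEQ_unique[OF delta_tendsto[OF F u]])
    have "isCont \<mu> (apply_bcontfun u n)"
      by (rule field_differentiable_imp_continuous_at[OF fd[OF norm_linf_coord_le[OF u]]])
    moreover have "(\<lambda>N. cc (approx N u) n) \<longlonglongrightarrow> apply_bcontfun u n"
      using pairing_approx_tendsto[OF unit_seq_ell1] unfolding pairing_unit_seq .
    ultimately have "(\<lambda>N. \<mu> (cc (approx N u) n)) \<longlonglongrightarrow> \<mu> (apply_bcontfun u n)"
      by (rule isCont_tendsto_compose)
    then show "(\<lambda>N. F (approx N u)) \<longlonglongrightarrow> \<mu> (apply_bcontfun u n)"
      using norm_approx_less[OF u] by (simp add: F_def)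
  qed
  have "supnorm F \<le> 1" using \<mu>1 cc by (intro supnorm_le) (auto simp: F_def)
  moreover have "delta w F = 0" using dF[OF w] by (simp add: \<mu>_def b_def)
  ultimately have "norm (delta z F) \<le> pseudo_hyp Au (delta z) (delta w)"
    using norm_delta_le z F by (intro norm_le_pseudo_hyp) auto
  then have "norm (\<mu> (apply_bcontfun z n)) \<le> pseudo_hyp Au (delta z) (delta w)"
    by (simp add: dF[OF z])
  then have *: "norm (of_real t * apply_bcontfun z n - of_real t * b) \<le> pseudo_hyp Au (delta z) (delta w) *
      norm (1 - cnj (of_real t * b) * (of_real t * apply_bcontfun z n))"
    using ne[OF norm_linf_coord_le[OF z]] unfolding \<mu>_def norm_divide by (simp add: divide_le_eq)
  have "norm (of_real t * apply_bcontfun z n - of_real t * b) = t * norm (apply_bcontfun z n - b)"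
    using assms(3) by (simp add: norm_mult flip: right_diff_distrib)
  with * show ?thesis by (simp add: b_def power2_eq_square mult_ac)
qed


section \<open>Gleason parts\<close>

text \<open>The analytic disc \<open>\<gamma>\<close> has \<open>\<gamma> 0 = b\<close> and \<open>\<gamma> c = a\<close> in every coordinate.\<close>

lemma Schwarz_Pick_polydisc:
  assumes f: "f \<in> Hinf" "supnorm f \<le> 1" and c: "0 < c" "c < 1"
    and a: "\<And>n. n < N \<Longrightarrow> norm (a n) < 1" and b: "\<And>n. n < N \<Longrightarrow> norm (b n) < 1"
    and ab: "\<And>n. n < N \<Longrightarrow> norm (a n - b n) \<le> c * norm (1 - cnj (b n) * a n)"
  shows "norm (f (initial_segment N a)) \<le> c + (1 + c) * norm (f (initial_segment N b))"
proof -
  \<comment> \<open>The Moebius transform taking \<open>b n\<close> to 0 takes \<open>a n\<close> to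
    \<open>m n\<close>. As \<open>norm (m n) \<le> c\<close>, the linear map \<open>u n\<close>
    preserves the disc and sends \<open>c\<close> to \<open>m n\<close>; \<open>\<gamma> n\<close>
    follows it by the inverse transform.\<close>
  define m where "m n = (a n - b n) / (1 - cnj (b n) * a n)" for n
  define u where "u n \<zeta> = \<zeta> * (m n / of_real c)" for n and \<zeta> :: complex
  define \<gamma> where "\<gamma> n \<zeta> = (u n \<zeta> + b n) / (1 + cnj (b n) * u n \<zeta>)" for n \<zeta>
  have ne: "1 - cnj (b n) * a n \<noteq> 0" if "n < N" for n
    using moebius_denominator_ge[of "b n" "a n"] a[OF that] b[OF that] by auto
  have m: "norm (m n) \<le> c" if "n < N" for n
    using ab[OF that] ne[OF that] by (simp add: m_def norm_divide divide_le_eq)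
  have u1: "norm (u n \<zeta>) < 1" if "n < N" "norm \<zeta> < 1" for n \<zeta>
  proof -
    have "norm (m n / of_real c) \<le> 1" using m[OF that(1)] c by (simp add: norm_divide)
    then have "norm (u n \<zeta>) \<le> norm \<zeta> * 1" unfolding u_def norm_mult by (intro mult_left_mono) auto
    then show ?thesis using that(2) by simp
  qed
  have ne2: "1 + cnj (b n) * u n \<zeta> \<noteq> 0" if "n < N" "norm \<zeta> < 1" for n \<zeta>
    using moebius_denominator_ge[of "- b n" "u n \<zeta>"] u1[OF that] b[OF that(1)] by auto
  have \<gamma>1: "norm (\<gamma> n \<zeta>) < 1" if "n < N" "norm \<zeta> < 1" for n \<zeta>
  proof -
    have "(norm (u n \<zeta>))\<^sup>2 < 1" "(norm (b n))\<^sup>2 < 1"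
      using u1[OF that] b[OF that(1)] by (simp_all add: abs_square_less_1)
    then have "0 < (1 - (norm (u n \<zeta>))\<^sup>2) * (1 - (norm (- b n))\<^sup>2)" by simp
    then have "(norm (u n \<zeta> + b n))\<^sup>2 < (norm (1 + cnj (b n) * u n \<zeta>))\<^sup>2"
      using moebius_identity[of "- b n" "u n \<zeta>"] by simp
    then have "norm (u n \<zeta> + b n) < norm (1 + cnj (b n) * u n \<zeta>)"
      by (rule power2_less_imp_less) simp
    then show ?thesis using ne2[OF that] by (simp add: \<gamma>_def norm_divide)
  qed
  define h where "h \<zeta> = f (initial_segment N (\<lambda>n. \<gamma> n \<zeta>))" for \<zeta>
  have hol: "h holomorphic_on ball 0 1"
    unfolding holomorphic_on_def
  proof
    fix \<zeta> :: complex assume "\<zeta> \<in> ball 0 1"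
    then have \<zeta>: "norm \<zeta> < 1" by simp
    have "(\<gamma> n has_field_derivative deriv (\<gamma> n) \<zeta>) (at \<zeta>)" if "n < N" for n
      unfolding DERIV_deriv_iff_field_differentiable
      using ne2[OF that \<zeta>] unfolding \<gamma>_def u_def by (intro derivative_intros) auto
    then have "h field_differentiable (at \<zeta>)"
      unfolding h_def using norm_initial_segment_less_1[of N "\<lambda>n. \<gamma> n \<zeta>"] \<gamma>1 \<zeta>
      by (intro Hinf_curve[OF f(1) has_derivative_initial_segment]) auto
    then show "h field_differentiable (at \<zeta> within ball 0 1)"
      by (rule field_differentiable_at_within)
  qed
  have hb: "norm (h \<zeta>) \<le> 1" if "norm \<zeta> < 1" for \<zeta>
    using norm_le_supnorm[OF f(1) norm_initial_segment_less_1[of N "\<lambda>n. \<gamma> n \<zeta>"]] \<gamma>1 that f(2) unfolding h_def by fastforce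
  have \<gamma>0: "\<gamma> n 0 = b n" for n by (simp add: \<gamma>_def u_def)
  have \<gamma>c: "\<gamma> n (of_real c) = a n" if "n < N" for n
  proof -
    have uc: "u n (of_real c) = m n" using c by (simp add: u_def)
    have "1 + cnj (b n) * m n \<noteq> 0" using ne2[OF that, of "of_real c"] c uc by simp
    moreover have "m n + b n = a n * (1 + cnj (b n) * m n)"
      using ne[OF that] unfolding m_def by (simp add: field_simps)
    ultimately show ?thesis by (simp add: \<gamma>_def uc)
  qed
  have fins: "initial_segment N (\<lambda>n. \<gamma> n 0) = initial_segment N b" "initial_segment N (\<lambda>n. \<gamma> n (of_real c)) = initial_segment N a"
    using \<gamma>0 \<gamma>c by (auto intro!: c0_eqI)
  \<comment> \<open>The remainder proportional to \<open>norm (h 0)\<close> makes the estimate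
    stable under limits: later the values at the second points vanish only in the limit.\<close>
  have "norm (h (of_real c) - h 0) \<le> (1 + norm (h 0)) * norm (of_real c :: complex) / 1"
  proof (rule Schwarz_bound[of "\<lambda>\<zeta>. h \<zeta> - h 0"])
    show "(\<lambda>\<zeta>. h \<zeta> - h 0) holomorphic_on ball 0 1" using hol by (intro holomorphic_intros)
    show "norm (h z - h 0) \<le> 1 + norm (h 0)" if "norm z < 1" for z
      using norm_triangle_ineq4[of "h z" "h 0"] hb[OF that] by linarith
  qed (use c in auto)
  then have "norm (h (of_real c) - h 0) \<le> c + c * norm (h 0)" using c by (simp add: algebra_simps)
  then have "norm (h (of_real c)) \<le> c + (1 + c) * norm (h 0)"
    using norm_triangle_ineq2[of "h (of_real c)" "h 0"] by (simp add: algebra_simps)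
  then show ?thesis unfolding h_def fins .
qed

section \<open>Characters of \<open>Hinf\<close> and equality of their parts\<close>

lemma char_spaceD:
  assumes "\<phi> \<in> char_space A"
  shows "f \<in> A \<Longrightarrow> g \<in> A \<Longrightarrow> \<phi> (\<lambda>x\<in>ball 0 1. f x + g x) = \<phi> f + \<phi> g"
    and "f \<in> A \<Longrightarrow> \<phi> (\<lambda>x\<in>ball 0 1. c * f x) = c * \<phi> f"
    and "f \<in> A \<Longrightarrow> g \<in> A \<Longrightarrow> \<phi> (\<lambda>x\<in>ball 0 1. f x * g x) = \<phi> f * \<phi> g"
  using assms unfolding char_space_def by blast+

lemma Hinf_extensional: "f \<in> Hinf \<Longrightarrow> f \<in> extensional (ball 0 1)"
  by (simp add: Hinf_def)

lemma char_one:
  assumes "\<phi> \<in> char_space Hinf"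
  shows "\<phi> (\<lambda>x\<in>ball 0 1. 1) = 1"
proof -
  obtain f where f: "f \<in> Hinf" "\<phi> f \<noteq> 0" using assms unfolding char_space_def by blast
  have "(\<lambda>x\<in>ball 0 1. f x * (\<lambda>x\<in>ball 0 1. 1) x) = f"
    by (rule extensionalityI[of _ "ball 0 1"]) (auto simp: Hinf_extensional[OF f(1)])
  then show ?thesis using char_spaceD(3)[OF assms f(1) Hinf_const[of 1]] f(2) by simp
qed

lemma char_affine:
  assumes "\<phi> \<in> char_space Hinf" "f \<in> Hinf"
  shows "(\<lambda>x\<in>ball 0 1. p + q * f x) \<in> Hinf" "\<phi> (\<lambda>x\<in>ball 0 1. p + q * f x) = p + q * \<phi> f"
proof -
  let ?p = "\<lambda>x\<in>ball 0 1. p * (\<lambda>x\<in>ball 0 1. 1) x" and ?q = "\<lambda>x\<in>ball 0 1. q * f x"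
  have h: "?p \<in> Hinf" "?q \<in> Hinf" by (intro Hinf_cmult Hinf_const assms)+
  have eq: "(\<lambda>x\<in>ball 0 1. ?p x + ?q x) = (\<lambda>x\<in>ball 0 1. p + q * f x)" by (intro restrict_ext) simp
  show "(\<lambda>x\<in>ball 0 1. p + q * f x) \<in> Hinf" using Hinf_add[OF h] unfolding eq .
  show "\<phi> (\<lambda>x\<in>ball 0 1. p + q * f x) = p + q * \<phi> f"
    using char_spaceD(1)[OF assms(1) h]
    unfolding eq char_spaceD(2)[OF assms(1) Hinf_const] char_spaceD(2)[OF assms] char_one[OF assms(1)] by simp
qed

lemma char_mult_eq:
  assumes "\<phi> \<in> char_space Hinf" "f \<in> Hinf" "g \<in> Hinf" "h \<in> Hinf"
    and "\<And>x. norm x < 1 \<Longrightarrow> f x * g x = h x"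
  shows "\<phi> f * \<phi> g = \<phi> h"
proof -
  have "(\<lambda>x\<in>ball 0 1. f x * g x) = h"
    by (rule extensionalityI[of _ "ball 0 1"]) (auto simp: Hinf_extensional assms)
  then show ?thesis using char_spaceD(3)[OF assms(1-3)] by simp
qed

text \<open>If \<open>norm (\<phi> f) > 1\<close>, then \<open>\<phi> f - f\<close> is bounded away
  from 0 on the ball and has an inverse in \<open>Hinf\<close>. But \<phi> maps it to 0 and its
  product with the inverse to 1.\<close>

lemma norm_char_le:
  assumes \<phi>: "\<phi> \<in> char_space Hinf" and f: "f \<in> Hinf" "supnorm f \<le> 1"
  shows "norm (\<phi> f) \<le> 1"
proof (rule ccontr)
  assume "\<not> norm (\<phi> f) \<le> 1"
  then have gt: "1 < norm (\<phi> f)" by simp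
  have lb: "norm (\<phi> f) - 1 \<le> norm (\<phi> f - f x)" if "norm x < 1" for x
    using norm_triangle_ineq2[of "\<phi> f" "f x"] norm_le_supnorm[OF f(1) that] f(2) by linarith
  then have ne: "\<phi> f - f x \<noteq> 0" if "norm x < 1" for x using gt that by fastforce
  have inv: "(\<lambda>x\<in>ball 0 1. inverse (\<phi> f - f x)) \<in> Hinf"
  proof (rule Hinf_compose[OF f(1), of "\<lambda>\<zeta>. inverse (\<phi> f - \<zeta>)" "inverse (norm (\<phi> f) - 1)"])
    show "norm (inverse (\<phi> f - f x)) \<le> inverse (norm (\<phi> f) - 1)" if "norm x < 1" for x
      unfolding norm_inverse using lb[OF that] gt by (intro le_imp_inverse_le) auto
  qed (auto intro!: derivative_intros ne)
  have "\<phi> (\<lambda>x\<in>ball 0 1. \<phi> f + (-1) * f x) * \<phi> (\<lambda>x\<in>ball 0 1. inverse (\<phi> f - f x)) = \<phi> (\<lambda>x\<in>ball 0 1. 1)"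
    using ne by (intro char_mult_eq[OF \<phi> char_affine(1)[OF \<phi> f(1)] inv Hinf_const]) auto
  then show False using char_affine(2)[OF \<phi> f(1), of "\<phi> f" "-1"] char_one[OF \<phi>] by simp
qed

lemma pseudo_hyp_nonneg:
  assumes "\<phi> \<in> char_space Hinf" "\<psi> \<in> char_space Hinf"
  shows "0 \<le> pseudo_hyp Hinf \<phi> \<psi>"
proof -
  let ?o = "\<lambda>x\<in>ball 0 1. 0 * (\<lambda>x\<in>ball 0 1. 1::complex) x"
  have "?o \<in> Hinf" by (intro Hinf_cmult Hinf_const)
  moreover have "supnorm ?o \<le> 1" by (rule supnorm_le) simp
  moreover have "\<phi> ?o = 0" "\<psi> ?o = 0"
    using char_spaceD(2)[OF assms(1) Hinf_const, of 0] char_spaceD(2)[OF assms(2) Hinf_const, of 0] by simp_all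
  ultimately show ?thesis
    using norm_le_pseudo_hyp[of Hinf \<phi> ?o \<psi>] norm_char_le[OF assms(1)] by simp
qed

text \<open>The zero function, seen as 0 times the unit, is annihilated by \<psi>; so the supremum
  is over a nonempty set.\<close>

lemma pseudo_hyp_le:
  assumes "\<psi> \<in> char_space A" "(\<lambda>x\<in>ball 0 1. 1) \<in> A" "(\<lambda>x\<in>ball 0 1. 0) \<in> A"
    "\<And>f. f \<in> A \<Longrightarrow> supnorm f \<le> 1 \<Longrightarrow> \<psi> f = 0 \<Longrightarrow> norm (\<phi> f) \<le> B"
  shows "pseudo_hyp A \<phi> \<psi> \<le> B"
  unfolding pseudo_hyp_def
proof (rule cSup_least)
  have "(\<lambda>x\<in>ball 0 1. 0 * (\<lambda>x\<in>ball 0 1. 1::complex) x) = (\<lambda>x\<in>ball 0 1. 0)"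
    by (intro restrict_ext) simp
  then have "\<psi> (\<lambda>x\<in>ball 0 1. 0) = 0"
    using char_spaceD(2)[OF assms(1,2), of 0] by simp
  moreover have "supnorm (\<lambda>x\<in>ball 0 1. 0) \<le> 1" by (rule supnorm_le) simp
  ultimately show "{norm (\<phi> f) |f. f \<in> A \<and> supnorm f \<le> 1 \<and> \<psi> f = 0} \<noteq> {}" using assms(3) by blast
qed (use assms(4) in blast)

lemma char_in_own_gleason_part:
  assumes "\<phi> \<in> char_space A" "(\<lambda>x\<in>ball 0 1. 1) \<in> A" "(\<lambda>x\<in>ball 0 1. 0) \<in> A"
  shows "\<phi> \<in> gleason_part A \<phi>"
  using pseudo_hyp_le[OF assms, of \<phi> 0] assms(1) by (simp add: gleason_part_def)

text \<open>The Moebius transform \<open>(t f - b) / (1 - cnj b t f)\<close> of a function vanishing at \<open>\<theta>\<close> turns the bound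
  on \<open>\<rho>(\<phi>, \<psi>)\<close> into a bound on the pseudo-hyperbolic distance of \<open>t \<phi> f\<close> and \<open>b = t \<psi> f\<close>; the factor
  \<open>t < 1\<close> keeps the denominator away from zero.\<close>

lemma pseudo_hyp_less_one_trans:
  assumes ch: "\<phi> \<in> char_space Hinf" "\<psi> \<in> char_space Hinf" "\<theta> \<in> char_space Hinf"
    and "pseudo_hyp Hinf \<phi> \<psi> < 1" "pseudo_hyp Hinf \<phi> \<theta> < 1"
  shows "pseudo_hyp Hinf \<psi> \<theta> < 1"
proof -
  define c1 c2 where "c1 = pseudo_hyp Hinf \<phi> \<psi>" and "c2 = pseudo_hyp Hinf \<phi> \<theta>"
  have c: "0 \<le> c1" "c1 < 1" "0 \<le> c2" "c2 < 1"
    using assms pseudo_hyp_nonneg by (auto simp: c1_def c2_def)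
  \<comment> \<open>Since \<open>norm a \<le> c2\<close>, the denominator
    \<open>1 - cnj b * a\<close> has modulus at least \<open>1 - c2\<close>; inserted in
    \<open>moebius_identity\<close> this gives \<open>(norm b)\<^sup>2 \<le> 1 - \<kappa>\<close>
    for all \<open>f\<close> and \<open>t\<close> at once.\<close>
  define \<kappa> where "\<kappa> = (1 - c1\<^sup>2) * (1 - c2)\<^sup>2"
  have c1': "0 < 1 - c1\<^sup>2" using c by (simp add: abs_square_less_1)
  then have \<kappa>: "0 < \<kappa>" using c by (simp add: \<kappa>_def)
  have le: "norm (\<psi> f) \<le> sqrt (1 - \<kappa>)" if f: "f \<in> Hinf" "supnorm f \<le> 1" "\<theta> f = 0" for f
  proof (rule field_le_mult_one_interval)
    fix t :: real assume t: "0 < t" "t < 1"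
    define a b where "a = of_real t * \<phi> f" and "b = of_real t * \<psi> f"
    have "norm (\<phi> f) \<le> c2"
      unfolding c2_def using norm_char_le[OF ch(1)] f by (intro norm_le_pseudo_hyp)
    then have a: "norm a \<le> c2"
      using t mult_mono[of t 1 "norm (\<phi> f)" c2] unfolding a_def norm_mult norm_of_real by simp
    have tb: "norm (of_real t * \<zeta>) < 1" if "norm \<zeta> \<le> 1" for \<zeta> :: complex
      using t that mult_left_mono[of "norm \<zeta>" 1 t] unfolding norm_mult norm_of_real by linarith
    have b: "norm b < 1" unfolding b_def by (intro tb norm_char_le ch f)
    have f1: "norm (f x) \<le> 1" if "norm x < 1" for x
      using norm_le_supnorm[OF f(1) that] f(2) by linarith
    define \<mu> where "\<mu> \<zeta> = (of_real t * \<zeta> - b) / (1 - cnj b * (of_real t * \<zeta>))" for \<zeta>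
    have ne: "1 - cnj b * (of_real t * \<zeta>) \<noteq> 0" if "norm \<zeta> \<le> 1" for \<zeta>
      using moebius_denominator_ge[of b "of_real t * \<zeta>"] tb[OF that] b by auto
    have \<mu>1: "norm (\<mu> \<zeta>) \<le> 1" if "norm \<zeta> \<le> 1" for \<zeta>
      using moebius_le[of "of_real t * \<zeta>" b] tb[OF that] b ne[OF that]
      unfolding \<mu>_def norm_divide by (simp add: divide_le_eq_1)
    define F where "F = (\<lambda>x\<in>ball 0 1. \<mu> (f x))"
    have F: "F \<in> Hinf" unfolding F_def
    proof (rule Hinf_compose[OF f(1), of \<mu> 1])
      show "\<mu> field_differentiable at (f x)" if "norm x < 1" for x
        unfolding \<mu>_def using ne[OF f1[OF that]] by (intro derivative_intros) auto
    qed (use \<mu>1 f1 in auto)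
    have sF: "supnorm F \<le> 1" using \<mu>1 f1 by (intro supnorm_le) (auto simp: F_def)
    \<comment> \<open>Characters commute with the Moebius transform: in the algebra,
      \<open>F\<close> times the denominator is the numerator, and both are affine in
      \<open>f\<close>.\<close>
    have chF: "\<xi> F * (1 - cnj b * (of_real t * \<xi> f)) = of_real t * \<xi> f - b" if \<xi>: "\<xi> \<in> char_space Hinf" for \<xi>
    proof -
      have "\<xi> F * \<xi> (\<lambda>x\<in>ball 0 1. 1 + (- (cnj b * of_real t)) * f x) = \<xi> (\<lambda>x\<in>ball 0 1. - b + of_real t * f x)"
      proof (rule char_mult_eq[OF \<xi> F char_affine(1)[OF \<xi> f(1)] char_affine(1)[OF \<xi> f(1)]])
        fix x :: c0 assume "norm x < 1"
        then show "F x * (\<lambda>x\<in>ball 0 1. 1 + (- (cnj b * of_real t)) * f x) x = (\<lambda>x\<in>ball 0 1. - b + of_real t * f x) x"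
          using ne[OF f1] by (simp add: F_def \<mu>_def mult.assoc)
      qed
      then show ?thesis unfolding char_affine(2)[OF \<xi> f(1)] by (simp add: mult.assoc)
    qed
    have "\<psi> F * (1 - cnj b * b) = 0" using chF[OF ch(2)] by (simp flip: b_def)
    moreover have "1 - cnj b * b \<noteq> 0" using moebius_denominator_ge[of b b] b by auto
    ultimately have "\<psi> F = 0" by simp
    then have "norm (\<phi> F) \<le> c1"
      unfolding c1_def using norm_char_le[OF ch(1)] F sF by (intro norm_le_pseudo_hyp)
    then have "norm (\<phi> F) * norm (1 - cnj b * a) \<le> c1 * norm (1 - cnj b * a)"
      by (intro mult_right_mono) auto
    moreover have "norm (\<phi> F) * norm (1 - cnj b * a) = norm (a - b)"
      using chF[OF ch(1)] unfolding a_def norm_mult[symmetric] by simp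
    ultimately have "norm (a - b) \<le> c1 * norm (1 - cnj b * a)" by simp
    then have "(norm (a - b))\<^sup>2 \<le> c1\<^sup>2 * (norm (1 - cnj b * a))\<^sup>2"
      unfolding power_mult_distrib[symmetric] by (rule power_mono) simp
    then have "(1 - c1\<^sup>2) * (norm (1 - cnj b * a))\<^sup>2 \<le> (1 - (norm a)\<^sup>2) * (1 - (norm b)\<^sup>2)"
      using moebius_identity[of b a] by (simp add: algebra_simps)
    also have "\<dots> \<le> 1 * (1 - (norm b)\<^sup>2)"
      using b by (intro mult_right_mono) (auto simp: power_le_one)
    finally have "(1 - c1\<^sup>2) * (norm (1 - cnj b * a))\<^sup>2 \<le> 1 - (norm b)\<^sup>2" by simp
    moreover have "\<kappa> \<le> (1 - c1\<^sup>2) * (norm (1 - cnj b * a))\<^sup>2"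
      unfolding \<kappa>_def using c c1' a b moebius_denominator_ge[of b a]
      by (intro mult_left_mono power_mono) auto
    ultimately have "(norm b)\<^sup>2 \<le> 1 - \<kappa>" by linarith
    then have "norm b \<le> sqrt (1 - \<kappa>)" by (rule real_le_rsqrt)
    then show "t * norm (\<psi> f) \<le> sqrt (1 - \<kappa>)" using t by (simp add: b_def norm_mult)
  qed
  have "pseudo_hyp Hinf \<psi> \<theta> \<le> sqrt (1 - \<kappa>)"
    by (rule pseudo_hyp_le[OF ch(3) Hinf_const Hinf_const le])
  also have "\<dots> < 1" using \<kappa> by simp
  finally show ?thesis .
qed

text \<open>Symmetry is the case \<open>\<theta> = \<phi>\<close> of
  \<open>pseudo_hyp_less_one_trans\<close>; with it the same lemma gives both inclusions.\<close>

lemma gleason_part_eq: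
  assumes ch: "\<phi> \<in> char_space Hinf" "\<psi> \<in> char_space Hinf" and lt: "pseudo_hyp Hinf \<phi> \<psi> < 1"
  shows "gleason_part Hinf \<phi> = gleason_part Hinf \<psi>"
proof -
  have "pseudo_hyp Hinf \<phi> \<phi> < 1"
    using char_in_own_gleason_part[OF ch(1) Hinf_const Hinf_const] by (simp add: gleason_part_def)
  then have "pseudo_hyp Hinf \<psi> \<phi> < 1"
    by (rule pseudo_hyp_less_one_trans[OF ch ch(1) lt])
  then show ?thesis
    using pseudo_hyp_less_one_trans ch lt unfolding gleason_part_def by blast
qed


section \<open>Limit characters in the fibers\<close>

lemma compact_PiE_UNIV:
  assumes "\<And>i. compact (S i)"
  shows "compact (PiE UNIV S)"
proof -
  have "compactin (product_topology (\<lambda>i. euclidean) UNIV) (PiE UNIV S)"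
    using assms by (simp add: compactin_PiE)
  then show ?thesis by (simp add: euclidean_product_topology)
qed

text \<open>Tychonoff's theorem for the sequence of pairs of evaluations gives a cluster point, and \<open>G\<close>
  consists of the indices at which the sequence is close to it.\<close>

lemma common_limit_filter:
  assumes "\<And>k. norm (x k) < 1" "\<And>k. norm (y k) < 1"
  obtains G :: "nat filter" where "G \<noteq> bot" "G \<le> sequentially"
    "\<And>f. f \<in> Hinf \<Longrightarrow> \<exists>l. ((\<lambda>k. f (x k)) \<longlongrightarrow> l) G" "\<And>f. f \<in> Hinf \<Longrightarrow> \<exists>l. ((\<lambda>k. f (y k)) \<longlongrightarrow> l) G"
proof -
  \<comment> \<open>Recording both values as a pair makes the two sequences converge along one
    filter. The value 0 outside \<open>Hinf\<close> keeps every factor of the product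
    compact.\<close>
  define E where "E k f = (if f \<in> Hinf then (f (x k), f (y k)) else 0)" for k f
  define K where "K = PiE UNIV (\<lambda>f. cball (0::complex) (supnorm f) \<times> cball (0::complex) (supnorm f) \<union> {0})"
  have "compact K" unfolding K_def
    by (intro compact_PiE_UNIV compact_Un compact_Times) auto
  moreover have "\<forall>\<^sub>F e in filtermap E sequentially. e \<in> K"
    using norm_le_supnorm assms unfolding eventually_filtermap K_def E_def by (auto simp: PiE_UNIV_domain)
  moreover have "filtermap E sequentially \<noteq> bot" by (simp add: filtermap_bot_iff)
  ultimately obtain \<Phi> where \<Phi>: "inf (nhds \<Phi>) (filtermap E sequentially) \<noteq> bot"
    unfolding compact_filter by blast
  define G where "G = inf sequentially (filtercomap E (nhds \<Phi>))"
  have "G \<noteq> bot"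
  proof
    assume "G = bot"
    then have "\<forall>\<^sub>F k in G. False" by simp
    then obtain P Q where P: "eventually P sequentially" "eventually Q (filtercomap E (nhds \<Phi>))"
      and PQ: "\<And>k. P k \<Longrightarrow> Q k \<Longrightarrow> False"
      unfolding G_def eventually_inf by blast
    obtain R where R: "eventually R (nhds \<Phi>)" "\<And>k. R (E k) \<Longrightarrow> Q k"
      using P(2) unfolding eventually_filtercomap by blast
    have "\<forall>\<^sub>F e in filtermap E sequentially. \<not> R e"
      unfolding eventually_filtermap using P(1) by (rule eventually_mono) (use PQ R(2) in blast)
    then have "\<forall>\<^sub>F e in inf (nhds \<Phi>) (filtermap E sequentially). False"
      unfolding eventually_inf using R(1) by blast
    then show False using \<Phi> by (simp add: eventually_False)
  qed
  moreover have "G \<le> sequentially" by (simp add: G_def)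
  moreover have lim: "((\<lambda>k. E k f) \<longlongrightarrow> \<Phi> f) G" for f
  proof -
    have "filtermap E G \<le> filtermap E (filtercomap E (nhds \<Phi>))" unfolding G_def by (intro filtermap_mono) simp
    also have "\<dots> \<le> nhds \<Phi>" by (rule filtermap_filtercomap)
    finally have "(E \<longlongrightarrow> \<Phi>) G" by (simp add: filterlim_def)
    moreover have "open ((\<lambda>e. e f) -` U)" if "open U" for U :: "(complex \<times> complex) set"
      using that by (rule open_vimage[OF _ continuous_on_product_coordinates])
    ultimately show ?thesis
      using topological_tendstoD[of E \<Phi> G "(\<lambda>e. e f) -` U" for U] by (intro topological_tendstoI) auto
  qed
  have "((\<lambda>k. f (x k)) \<longlongrightarrow> fst (\<Phi> f)) G" "((\<lambda>k. f (y k)) \<longlongrightarrow> snd (\<Phi> f)) G" if "f \<in> Hinf" for f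
    using tendsto_fst[OF lim[of f]] tendsto_snd[OF lim[of f]] that by (simp_all add: E_def)
  ultimately show ?thesis using that by blast
qed

text \<open>The algebraic identities of evaluations pass to the limit along \<open>G\<close>. As
  \<open>G\<close> refines \<open>sequentially\<close>, the limit acts on \<open>ell1\<close> as
  \<open>z\<close> does, and unit sequences show that only \<open>z\<close> acts so.\<close>

lemma fiber_limit:
  assumes G: "G \<noteq> bot" "G \<le> sequentially" and z: "norm z \<le> 1"
    and ex: "\<And>f. f \<in> Hinf \<Longrightarrow> \<exists>l. ((\<lambda>k. f (approx k z)) \<longlongrightarrow> l) G"
  obtains \<phi> where "\<phi> \<in> fiber Hinf z" "\<And>f. f \<in> Hinf \<Longrightarrow> ((\<lambda>k. f (approx k z)) \<longlongrightarrow> \<phi> f) G"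
proof -
  have ball: "approx k z \<in> ball 0 1" for k using norm_approx_less[OF z] by simp
  have "\<forall>f. \<exists>l. f \<in> Hinf \<longrightarrow> ((\<lambda>k. f (approx k z)) \<longlongrightarrow> l) G" using ex by blast
  from choice[OF this] obtain \<phi>0 where \<phi>0: "\<And>f. f \<in> Hinf \<Longrightarrow> ((\<lambda>k. f (approx k z)) \<longlongrightarrow> \<phi>0 f) G"
    by blast
  define \<phi> where "\<phi> = restrict \<phi>0 Hinf"
  have lim: "((\<lambda>k. f (approx k z)) \<longlongrightarrow> \<phi> f) G" if "f \<in> Hinf" for f
    using \<phi>0[OF that] that by (simp add: \<phi>_def)
  have uniq: "\<phi> g = l" if "g \<in> Hinf" "((\<lambda>k. g (approx k z)) \<longlongrightarrow> l) G" for g l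
    using tendsto_unique[OF G(1) lim[OF that(1)] that(2)] .
  have "\<phi> \<in> char_space Hinf"
    unfolding char_space_def
  proof (intro CollectI conjI ballI allI)
    show "\<phi> \<in> extensional Hinf" by (simp add: \<phi>_def)
    show "\<phi> (\<lambda>x\<in>ball 0 1. f x + g x) = \<phi> f + \<phi> g" if "f \<in> Hinf" "g \<in> Hinf" for f g
      using tendsto_add[OF lim[OF that(1)] lim[OF that(2)]] ball by (intro uniq Hinf_add that) simp
    show "\<phi> (\<lambda>x\<in>ball 0 1. f x * g x) = \<phi> f * \<phi> g" if "f \<in> Hinf" "g \<in> Hinf" for f g
      using tendsto_mult[OF lim[OF that(1)] lim[OF that(2)]] ball by (intro uniq Hinf_mult that) simp
    show "\<phi> (\<lambda>x\<in>ball 0 1. c * f x) = c * \<phi> f" if "f \<in> Hinf" for f c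
      using tendsto_mult_left[OF lim[OF that], of c] ball by (intro uniq Hinf_cmult that) simp
    have "\<phi> (\<lambda>x\<in>ball 0 1. 1) = 1" using ball by (intro uniq Hinf_const) simp
    then show "\<exists>f\<in>Hinf. \<phi> f \<noteq> 0" using Hinf_const[of 1] by force
  qed
  moreover have "char_proj \<phi> = z"
    unfolding char_proj_def
  proof (rule the_equality)
    show proj: "\<forall>a\<in>ell1. \<phi> (ell1_fun a) = pairing a z"
    proof
      fix a assume a: "a \<in> ell1"
      have "((\<lambda>k. pairing a (c0_linf (approx k z))) \<longlongrightarrow> pairing a z) G"
        using pairing_approx_tendsto[OF a] G(2) by (rule tendsto_mono[rotated])
      then show "\<phi> (ell1_fun a) = pairing a z"
        using ball by (intro uniq ell1_fun_Hinf a) (simp add: ell1_fun_def)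
    qed
    fix u assume "\<forall>a\<in>ell1. \<phi> (ell1_fun a) = pairing a u"
    then have "pairing (unit_seq n) u = pairing (unit_seq n) z" for n
      using proj unit_seq_ell1[of n] by metis
    then show "u = z" unfolding pairing_unit_seq by (intro bcontfun_eqI)
  qed
  ultimately have "\<phi> \<in> fiber Hinf z" by (simp add: fiber_def)
  then show ?thesis using that lim by blast
qed

theorem proposition3p2:
  fixes z w :: linf
  assumes "z \<in> sphere 0 1" and "w \<in> sphere 0 1"
    and "gleason_part Au (delta z) = gleason_part Au (delta w)"
  shows "\<exists>\<phi>\<in>fiber Hinf z. \<exists>\<psi>\<in>fiber Hinf w. gleason_part Hinf \<phi> = gleason_part Hinf \<psi>"
proof -
  have z: "norm z \<le> 1" and w: "norm w \<le> 1" using assms(1,2) by auto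
  have "delta w \<in> gleason_part Au (delta z)"
    using char_in_own_gleason_part[OF delta_in_char_space[OF w] Au_const Au_const] assms(3) by simp
  then have lt: "pseudo_hyp Au (delta z) (delta w) < 1" by (simp add: gleason_part_def)
  \<comment> \<open>The analytic disc divides by \<open>c\<close>, so the maximum with 1/2 keeps it
    positive.\<close>
  define c where "c = max (1/2) (pseudo_hyp Au (delta z) (delta w))"
  have c: "0 < c" "c < 1" "pseudo_hyp Au (delta z) (delta w) \<le> c" using lt by (auto simp: c_def)
  \<comment> \<open>The scaling factor of \<open>approx k\<close> serves as \<open>t\<close> in
    \<open>pseudo_hyp_coordinate\<close>; the resulting bound \<open>c\<close> does not depend on
    \<open>k\<close>.\<close>
  have SP: "norm (f (approx k z)) \<le> c + (1 + c) * norm (f (approx k w))" if f: "f \<in> Hinf" "supnorm f \<le> 1" for f k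
    unfolding approx_def
  proof (rule Schwarz_Pick_polydisc[OF f c(1,2)])
    let ?t = "(real k + 1) / (real k + 2)"
    fix n
    have t: "0 < ?t" "?t < 1" by (rule shrink_factor)+
    have "?t * norm (apply_bcontfun u n) < 1" if "norm u \<le> 1" for u :: linf
      using mult_left_mono[OF norm_linf_coord_le[OF that, of n], of ?t] t by linarith
    then show "norm (of_real ?t * apply_bcontfun z n) < 1" "norm (of_real ?t * apply_bcontfun w n) < 1"
      using z w t unfolding norm_mult norm_of_real by simp_all
    let ?d = "norm (1 - cnj (of_real ?t * apply_bcontfun w n) * (of_real ?t * apply_bcontfun z n))"
    have "norm (of_real ?t * apply_bcontfun z n - of_real ?t * apply_bcontfun w n) =
        ?t * norm (apply_bcontfun z n - apply_bcontfun w n)"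
      using t unfolding right_diff_distrib[symmetric] norm_mult norm_of_real by simp
    also have "\<dots> \<le> pseudo_hyp Au (delta z) (delta w) *
        norm (1 - (of_real ?t)\<^sup>2 * cnj (apply_bcontfun w n) * apply_bcontfun z n)"
      by (rule pseudo_hyp_coordinate[OF z w t])
    also have "\<dots> = pseudo_hyp Au (delta z) (delta w) * ?d"
      by (simp add: power2_eq_square mult_ac del: of_real_divide)
    also have "\<dots> \<le> c * ?d" using c(3) by (intro mult_right_mono) auto
    finally show "norm (of_real ?t * apply_bcontfun z n - of_real ?t * apply_bcontfun w n) \<le> c * ?d" .
  qed
  obtain G :: "nat filter" where G: "G \<noteq> bot" "G \<le> sequentially"
    "\<And>f. f \<in> Hinf \<Longrightarrow> \<exists>l. ((\<lambda>k. f (approx k z)) \<longlongrightarrow> l) G"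
    "\<And>f. f \<in> Hinf \<Longrightarrow> \<exists>l. ((\<lambda>k. f (approx k w)) \<longlongrightarrow> l) G"
    using common_limit_filter[of "\<lambda>k. approx k z" "\<lambda>k. approx k w"] norm_approx_less z w by blast
  obtain \<phi> where \<phi>: "\<phi> \<in> fiber Hinf z" "\<And>f. f \<in> Hinf \<Longrightarrow> ((\<lambda>k. f (approx k z)) \<longlongrightarrow> \<phi> f) G"
    using fiber_limit[OF G(1,2) z G(3)] by blast
  obtain \<psi> where \<psi>: "\<psi> \<in> fiber Hinf w" "\<And>f. f \<in> Hinf \<Longrightarrow> ((\<lambda>k. f (approx k w)) \<longlongrightarrow> \<psi> f) G"
    using fiber_limit[OF G(1,2) w G(4)] by blast
  have ch: "\<phi> \<in> char_space Hinf" "\<psi> \<in> char_space Hinf" using \<phi>(1) \<psi>(1) by (auto simp: fiber_def)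
  have "pseudo_hyp Hinf \<phi> \<psi> \<le> c"
  proof (rule pseudo_hyp_le[OF ch(2) Hinf_const Hinf_const])
    fix f assume f: "f \<in> Hinf" "supnorm f \<le> 1" "\<psi> f = 0"
    have "((\<lambda>k. c + (1 + c) * norm (f (approx k w))) \<longlongrightarrow> c + (1 + c) * norm (\<psi> f)) G"
      by (intro tendsto_intros \<psi>(2) f)
    moreover have "((\<lambda>k. norm (f (approx k z))) \<longlongrightarrow> norm (\<phi> f)) G"
      by (intro tendsto_norm \<phi>(2) f)
    \<comment> \<open>The estimate \<open>SP\<close> holds at every index and passes to the limit
      along the common filter; there \<open>\<psi> f = 0\<close> removes the remainder.\<close>
    ultimately have "norm (\<phi> f) \<le> c + (1 + c) * norm (\<psi> f)"
      by (rule tendsto_le[OF G(1)]) (simp add: SP f)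
    then show "norm (\<phi> f) \<le> c" using f(3) by simp
  qed
  then have "gleason_part Hinf \<phi> = gleason_part Hinf \<psi>"
    using c(2) by (intro gleason_part_eq ch) simp
  with \<phi>(1) \<psi>(1) show ?thesis by blast
qed

end
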